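(* For every integer $n\ge 1$, the symmetric group $S_n$ is almost monomial.
   Context: A finite group $G$ is called almost monomial if for every two distinct complex irreducible characters $\chi$ and $\psi$ of $G$ there exist a subgroup $H\le G$ and a linear (degree one) character $\varphi$ of $H$ such that the induced character $\operatorname{Ind}_H^G\varphi$ contains $\chi$ (i.e. $\langle \operatorname{Ind}_H^G\varphi,\chi\rangle\neq 0$) and does not contain $\psi$ (i.e. $\langle \operatorname{Ind}_H^G\varphi,\psi\rangle=0$), where $\langle\,,\rangle$ is the usual inner product of class functions. *)

theory Defs
  imports "HOL-Algebra.Sym_Groups" "Jordan_Normal_Form.Matrix"
begin

definition is_rep :: "('a, 'b) monoid_scheme \<Rightarrow> nat \<Rightarrow> ('a \<Rightarrow> complex mat) \<Rightarrow> bool" where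
  "is_rep G d \<rho> \<longleftrightarrow>
     (\<forall>g\<in>carrier G. \<rho> g \<in> carrier_mat d d) \<and>
     (\<forall>g\<in>carrier G. \<forall>h\<in>carrier G. \<rho> (g \<otimes>\<^bsub>G\<^esub> h) = \<rho> g * \<rho> h) \<and>
     \<rho> \<one>\<^bsub>G\<^esub> = 1\<^sub>m d"

definition proper_invariant_subspace ::
  "('a, 'b) monoid_scheme \<Rightarrow> nat \<Rightarrow> ('a \<Rightarrow> complex mat) \<Rightarrow> complex vec set \<Rightarrow> bool" where
  "proper_invariant_subspace G d \<rho> W \<longleftrightarrow>
     W \<subseteq> carrier_vec d \<and> 0\<^sub>v d \<in> W \<and>
     (\<forall>v\<in>W. \<forall>w\<in>W. v + w \<in> W) \<and> (\<forall>c. \<forall>v\<in>W. c \<cdot>\<^sub>v v \<in> W) \<and>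
     (\<forall>g\<in>carrier G. \<forall>v\<in>W. \<rho> g *\<^sub>v v \<in> W) \<and>
     W \<noteq> {0\<^sub>v d} \<and> W \<noteq> carrier_vec d"

definition is_irr_rep :: "('a, 'b) monoid_scheme \<Rightarrow> nat \<Rightarrow> ('a \<Rightarrow> complex mat) \<Rightarrow> bool" where
  "is_irr_rep G d \<rho> \<longleftrightarrow> is_rep G d \<rho> \<and> d > 0 \<and> \<not> (\<exists>W. proper_invariant_subspace G d \<rho> W)"

definition rep_char :: "('a, 'b) monoid_scheme \<Rightarrow> nat \<Rightarrow> ('a \<Rightarrow> complex mat) \<Rightarrow> 'a \<Rightarrow> complex" where
  "rep_char G d \<rho> = (\<lambda>g\<in>carrier G. (\<Sum>i<d. \<rho> g $$ (i, i)))"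

definition irr_char :: "('a, 'b) monoid_scheme \<Rightarrow> ('a \<Rightarrow> complex) \<Rightarrow> bool" where
  "irr_char G \<chi> \<longleftrightarrow> (\<exists>d \<rho>. is_irr_rep G d \<rho> \<and> \<chi> = rep_char G d \<rho>)"

definition linear_char :: "('a, 'b) monoid_scheme \<Rightarrow> ('a \<Rightarrow> complex) \<Rightarrow> bool" where
  "linear_char G \<phi> \<longleftrightarrow> (\<exists>\<rho>. is_rep G 1 \<rho> \<and> \<phi> = rep_char G 1 \<rho>)"

definition ind_char :: "('a, 'b) monoid_scheme \<Rightarrow> 'a set \<Rightarrow> ('a \<Rightarrow> complex) \<Rightarrow> 'a \<Rightarrow> complex" where
  "ind_char G H \<phi> = (\<lambda>g\<in>carrier G. (1 / of_nat (card H)) *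
      (\<Sum>x\<in>carrier G. (if x \<otimes>\<^bsub>G\<^esub> g \<otimes>\<^bsub>G\<^esub> inv\<^bsub>G\<^esub> x \<in> H
                        then \<phi> (x \<otimes>\<^bsub>G\<^esub> g \<otimes>\<^bsub>G\<^esub> inv\<^bsub>G\<^esub> x) else 0)))"

definition char_inner :: "('a, 'b) monoid_scheme \<Rightarrow> ('a \<Rightarrow> complex) \<Rightarrow> ('a \<Rightarrow> complex) \<Rightarrow> complex" where
  "char_inner G \<alpha> \<beta> = (1 / of_nat (card (carrier G))) * (\<Sum>g\<in>carrier G. \<alpha> g * cnj (\<beta> g))"

definition almost_monomial :: "('a, 'b) monoid_scheme \<Rightarrow> bool" where
  "almost_monomial G \<longleftrightarrow>
     (\<forall>\<chi> \<psi>. irr_char G \<chi> \<and> irr_char G \<psi> \<and> \<chi> \<noteq> \<psi> \<longrightarrow>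
        (\<exists>H \<phi>. subgroup H G \<and> linear_char (G\<lparr>carrier := H\<rparr>) \<phi> \<and>
               char_inner G (ind_char G H \<phi>) \<chi> \<noteq> 0 \<and>
               char_inner G (ind_char G H \<phi>) \<psi> = 0))"

end

(*
For a Young diagram Y let M_Y be induced from the trivial character of the row group and N_Y from
the sign character of the column group of a tableau of shape Y. The pairing of M_Y and N_Z is
nonzero only if Z dominates Y, and it is nonzero for Y = Z. Moreover both families span the class
functions: an element of the Young subgroup of the orbit partition of g either has finer orbits or is
conjugate to g, so the M_Y are triangular in the class indicators, and the N_Z are obtained by a
twist with the sign.

Expand an irreducible chi as sum c_Y M_Y = sum d_Z N_Z. A minimal Y with c_Y nonzero occurs on the
column side, i.e. <N_Y, chi> is nonzero, and a maximal Z with d_Z nonzero occurs on the row side.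
Irreducibility forces Z to dominate Y whenever <M_Y, chi> and <N_Z, chi> are nonzero. Since
<chi, chi> is nonzero, all this collapses to a single L on both sides, with c_L and d_L nonzero, with
c supported above L and d supported below L. If no M_Y or N_Y separated chi from psi, both characters
would have the same L, and the pairing of chi and psi would reduce to the nonzero term
c_L d'_L <M_L, N_L>, against Schur orthogonality.
*)
theory Submission
  imports Defs
begin

section \<open>Irreducible representations and induced characters\<close>

text \<open>The dominance condition has one combinatorial source: a permutation \<open>p\<close> for
  which no row of Y and no column of Z, moved by \<open>p\<close>, share two points. Frobenius
  reciprocity makes <M_Y, N_Z> a positive multiple of the number of such \<open>p\<close>, because
  the sign sums to zero over every Young subgroup that contains a transposition. For an irreducible
  chi with both pairings nonzero, the symmetrizer A and the antisymmetrizer B have nonzero trace;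
  irreducibility gives a \<open>g\<close> with B rho(g) A nonzero, and two shared points would make
  this product equal to its own negative. The form that is expanded is bilinear, without
  conjugation. This fits both ends of the argument: M_Y and N_Z are real, so
  \<open>char_inner\<close> against them vanishes together with the bilinear form; they also agree
  at g and at its inverse, and this passes to every irreducible character through its expansion, so
  orthogonality can be stated with psi at the inverse of g.\<close>

lemma is_irr_rep_subspace:
  assumes "is_irr_rep G d \<rho>" "W \<subseteq> carrier_vec d" "0\<^sub>v d \<in> W"
    and "\<And>v w. v \<in> W \<Longrightarrow> w \<in> W \<Longrightarrow> v + w \<in> W"
    and "\<And>c v. v \<in> W \<Longrightarrow> c \<cdot>\<^sub>v v \<in> W"
    and "\<And>g v. g \<in> carrier G \<Longrightarrow> v \<in> W \<Longrightarrow> \<rho> g *\<^sub>v v \<in> W"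
  shows "W = {0\<^sub>v d} \<or> W = carrier_vec d"
proof (rule ccontr)
  assume "\<not> ?thesis"
  then have "proper_invariant_subspace G d \<rho> W"
    using assms(2-6) unfolding proper_invariant_subspace_def by simp
  then show False using assms(1) unfolding is_irr_rep_def by blast
qed

lemma mat_eq_0I:
  fixes A :: "'a :: semiring_1 mat"
  assumes A: "A \<in> carrier_mat m n" and 0: "\<And>v. v \<in> carrier_vec n \<Longrightarrow> A *\<^sub>v v = 0\<^sub>v m"
  shows "A = 0\<^sub>m m n"
proof (rule eq_matI)
  fix i j assume ij: "i < dim_row (0\<^sub>m m n :: 'a mat)" "j < dim_col (0\<^sub>m m n :: 'a mat)"
  have "(A *\<^sub>v unit_vec n j) $ i = A $$ (i, j)"
    using A ij by simp
  then show "A $$ (i, j) = 0\<^sub>m m n $$ (i, j)"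
    using 0[of "unit_vec n j"] ij by simp
qed (use A in auto)

lemma trace_mult_swap:
  fixes A B :: "'a :: comm_semiring_0 mat"
  assumes "A \<in> carrier_mat m n" "B \<in> carrier_mat n m"
  shows "(\<Sum>i<m. (A * B) $$ (i, i)) = (\<Sum>i<n. (B * A) $$ (i, i))"
proof -
  have "(\<Sum>i<m. (A * B) $$ (i, i)) = (\<Sum>i<m. \<Sum>j<n. A $$ (i, j) * B $$ (j, i))"
    using assms by (auto simp: scalar_prod_def lessThan_atLeast0 intro!: sum.cong)
  also have "\<dots> = (\<Sum>j<n. \<Sum>i<m. B $$ (j, i) * A $$ (i, j))"
    by (subst sum.swap) (simp add: mult.commute)
  also have "\<dots> = (\<Sum>i<n. (B * A) $$ (i, i))"
    using assms by (auto simp: scalar_prod_def lessThan_atLeast0 intro!: sum.cong)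
  finally show ?thesis .
qed

text \<open>Schur's lemma: the kernel and the image of an intertwiner are invariant subspaces, so a
  nonzero \<open>Y\<close> is injective and surjective. A two-sided inverse \<open>Z\<close> turns
  the intertwining relation into \<rho> g = Y \<sigma>(g) Z, and the trace is cyclic.\<close>

lemma schur_rep_char_eq:
  assumes \<rho>: "is_irr_rep G d \<rho>" and \<sigma>: "is_irr_rep G e \<sigma>"
    and Y: "Y \<in> carrier_mat d e"
    and comm: "\<And>g. g \<in> carrier G \<Longrightarrow> \<rho> g * Y = Y * \<sigma> g"
    and nz: "Y \<noteq> 0\<^sub>m d e"
  shows "rep_char G d \<rho> = rep_char G e \<sigma>"
proof -
  have \<rho>c: "\<rho> g \<in> carrier_mat d d" and \<sigma>c: "\<sigma> g \<in> carrier_mat e e" if "g \<in> carrier G" for g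
    using \<rho> \<sigma> that unfolding is_irr_rep_def is_rep_def by auto
  define K where "K = {v \<in> carrier_vec e. Y *\<^sub>v v = 0\<^sub>v d}"
  define I where "I = (\<lambda>v. Y *\<^sub>v v) ` carrier_vec e"
  have "K = {0\<^sub>v e} \<or> K = carrier_vec e"
  proof (rule is_irr_rep_subspace[OF \<sigma>])
    fix g v assume g: "g \<in> carrier G" and v: "v \<in> K"
    have vc: "v \<in> carrier_vec e" and v0: "Y *\<^sub>v v = 0\<^sub>v d"
      using v unfolding K_def by auto
    have "Y *\<^sub>v (\<sigma> g *\<^sub>v v) = (Y * \<sigma> g) *\<^sub>v v"
      using Y \<sigma>c[OF g] vc by (simp add: assoc_mult_mat_vec)
    also have "\<dots> = \<rho> g *\<^sub>v (Y *\<^sub>v v)"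
      using assoc_mult_mat_vec[OF \<rho>c[OF g] Y vc] by (simp add: comm[OF g])
    also have "\<dots> = 0\<^sub>v d"
      using \<rho>c[OF g] v0 by (intro eq_vecI) auto
    finally show "\<sigma> g *\<^sub>v v \<in> K"
      using \<sigma>c[OF g] vc unfolding K_def by auto
  qed (use Y in \<open>auto simp: K_def mult_add_distrib_mat_vec mult_mat_vec\<close>)
  moreover have "K \<noteq> carrier_vec e"
    using mat_eq_0I[OF Y] nz unfolding K_def by blast
  ultimately have K0: "K = {0\<^sub>v e}" by blast
  have "I = {0\<^sub>v d} \<or> I = carrier_vec d"
  proof (rule is_irr_rep_subspace[OF \<rho>])
    show "I \<subseteq> carrier_vec d" using Y unfolding I_def by auto
    have "Y *\<^sub>v 0\<^sub>v e = 0\<^sub>v d" using Y by (intro eq_vecI) auto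
    then show "0\<^sub>v d \<in> I" unfolding I_def by (metis imageI zero_carrier_vec)
  next
    fix v w assume "v \<in> I" "w \<in> I"
    then show "v + w \<in> I"
      using Y unfolding I_def by (auto simp flip: mult_add_distrib_mat_vec)
  next
    fix c v assume "v \<in> I"
    then show "c \<cdot>\<^sub>v v \<in> I"
      using Y unfolding I_def by (auto simp flip: mult_mat_vec)
  next
    fix g v assume g: "g \<in> carrier G" and "v \<in> I"
    then obtain u where u: "u \<in> carrier_vec e" "v = Y *\<^sub>v u" unfolding I_def by auto
    have "\<rho> g *\<^sub>v v = Y *\<^sub>v (\<sigma> g *\<^sub>v u)"
      unfolding u(2) assoc_mult_mat_vec[OF \<rho>c[OF g] Y u(1), symmetric]
        assoc_mult_mat_vec[OF Y \<sigma>c[OF g] u(1), symmetric] comm[OF g] ..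
    then show "\<rho> g *\<^sub>v v \<in> I"
      using mult_mat_vec_carrier[OF \<sigma>c[OF g] u(1)] unfolding I_def by blast
  qed
  moreover have "I \<noteq> {0\<^sub>v d}"
    using mat_eq_0I[OF Y] nz unfolding I_def by blast
  ultimately have I1: "I = carrier_vec d" by blast
  have "\<exists>w. \<forall>i<d. w i \<in> carrier_vec e \<and> Y *\<^sub>v w i = unit_vec d i"
  proof -
    have "\<exists>v. v \<in> carrier_vec e \<and> Y *\<^sub>v v = unit_vec d i" if "i < d" for i
    proof -
      have "unit_vec d i \<in> I" using I1 by simp
      then show ?thesis unfolding I_def by (metis imageE)
    qed
    then show ?thesis by metis
  qed
  then obtain w where w: "\<And>i. i < d \<Longrightarrow> w i \<in> carrier_vec e"
    "\<And>i. i < d \<Longrightarrow> Y *\<^sub>v w i = unit_vec d i" by blast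
  \<comment> \<open>The columns are preimages of the unit vectors under \<open>Y\<close>, so
    \<open>Z\<close> is a right inverse; it is a left inverse because \<open>Y\<close> kills every
    \<open>Z * Y *\<^sub>v v - v\<close> and has trivial kernel.\<close>
  define Z where "Z = mat_of_cols e (map w [0..<d])"
  have Z: "Z \<in> carrier_mat e d" unfolding Z_def by (rule carrier_matI) simp_all
  have YZ: "Y * Z = 1\<^sub>m d"
  proof (rule eq_matI)
    fix i j assume ij: "i < dim_row (1\<^sub>m d :: complex mat)" "j < dim_col (1\<^sub>m d :: complex mat)"
    have "col Z j = w j" unfolding Z_def using ij w by simp
    then have "(Y * Z) $$ (i, j) = (Y *\<^sub>v w j) $ i" using Y Z ij by simp
    also have "\<dots> = 1\<^sub>m d $$ (i, j)" using ij w(2)[of j] by simp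
    finally show "(Y * Z) $$ (i, j) = 1\<^sub>m d $$ (i, j)" .
  qed (use Y Z in auto)
  have ZY: "Z * Y = 1\<^sub>m e"
  proof -
    have "Z * Y - 1\<^sub>m e = 0\<^sub>m e e"
    proof (rule mat_eq_0I)
      fix v :: "complex vec" assume v: "v \<in> carrier_vec e"
      have ZYc: "Z * Y \<in> carrier_mat e e" using Z Y by simp
      have u: "(Z * Y) *\<^sub>v v \<in> carrier_vec e" using mult_mat_vec_carrier[OF ZYc v] .
      have eq: "(Z * Y - 1\<^sub>m e) *\<^sub>v v = (Z * Y) *\<^sub>v v - v"
        using v by (simp add: minus_mult_distrib_mat_vec[OF ZYc one_carrier_mat v])
      have "Y *\<^sub>v ((Z * Y) *\<^sub>v v) = (Y * (Z * Y)) *\<^sub>v v"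
        by (rule assoc_mult_mat_vec[OF Y ZYc v, symmetric])
      also have "Y * (Z * Y) = (Y * Z) * Y" by (rule assoc_mult_mat[OF Y Z Y, symmetric])
      also have "\<dots> = Y" unfolding YZ using Y by simp
      finally have "Y *\<^sub>v ((Z * Y) *\<^sub>v v - v) = 0\<^sub>v d"
        using mult_mat_vec_carrier[OF Y v] by (simp add: mult_minus_distrib_mat_vec[OF Y u v])
      then have "(Z * Y - 1\<^sub>m e) *\<^sub>v v \<in> K" unfolding K_def eq using u v by simp
      then show "(Z * Y - 1\<^sub>m e) *\<^sub>v v = 0\<^sub>v e" using K0 by simp
    qed (use Z Y in auto)
    then have "(Z * Y - 1\<^sub>m e) $$ (i, j) = 0" if "i < e" "j < e" for i j
      using that by simp
    then show ?thesis using Z Y by (intro eq_matI) auto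
  qed
  have "(\<Sum>i<d. \<rho> g $$ (i, i)) = (\<Sum>i<e. \<sigma> g $$ (i, i))" if g: "g \<in> carrier G" for g
  proof -
    have "\<rho> g = \<rho> g * Y * Z"
      using YZ Y Z \<rho>c[OF g] by (simp add: assoc_mult_mat[of _ d d _ e _ d])
    then have "\<rho> g = (Y * \<sigma> g) * Z" using comm[OF g] by simp
    then have "(\<Sum>i<d. \<rho> g $$ (i, i)) = (\<Sum>i<d. ((Y * \<sigma> g) * Z) $$ (i, i))" by simp
    also have "\<dots> = (\<Sum>i<e. (Z * (Y * \<sigma> g)) $$ (i, i))"
      using Y Z \<sigma>c[OF g] by (intro trace_mult_swap) auto
    also have "Z * (Y * \<sigma> g) = \<sigma> g"
      using ZY Y Z \<sigma>c[OF g] by (simp add: assoc_mult_mat[of _ e d _ e _ e, symmetric])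
    finally show ?thesis .
  qed
  then show ?thesis unfolding rep_char_def by (auto intro!: restrict_ext)
qed

section \<open>Schur orthogonality, products in an irreducible representation, Frobenius
  reciprocity\<close>

context group
begin

lemma inv_mult_cancel:
  assumes "x \<in> carrier G" "y \<in> carrier G"
  shows "inv x \<otimes> (x \<otimes> y) = y" "x \<otimes> (inv x \<otimes> y) = y"
  using assms by (simp_all add: m_assoc[symmetric])

lemma bij_betw_mult_left: "h \<in> carrier G \<Longrightarrow> bij_betw (\<lambda>g. h \<otimes> g) (carrier G) (carrier G)"
  by (rule bij_betwI[where g = "\<lambda>g. inv h \<otimes> g"]) (auto simp: inv_mult_cancel)

lemma bij_betw_conj:
  "x \<in> carrier G \<Longrightarrow> bij_betw (\<lambda>g. x \<otimes> g \<otimes> inv x) (carrier G) (carrier G)"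
  by (rule bij_betwI[where g = "\<lambda>g. inv x \<otimes> g \<otimes> x"]) (auto simp: m_assoc inv_mult_cancel)

text \<open>Averaging a matrix unit over the group gives an intertwiner, which Schur's lemma forces
  to be zero when the characters differ. Its entries are the orthogonality relations of the matrix
  coefficients; the diagonal ones add up to the claim.\<close>

lemma irr_char_orthogonal:
  assumes "irr_char G \<chi>" "irr_char G \<psi>" "\<chi> \<noteq> \<psi>"
  shows "(\<Sum>g\<in>carrier G. \<chi> g * \<psi> (inv g)) = 0"
proof -
  obtain d \<rho> e \<sigma> where \<rho>: "is_irr_rep G d \<rho>" and \<chi>: "\<chi> = rep_char G d \<rho>"
    and \<sigma>: "is_irr_rep G e \<sigma>" and \<psi>: "\<psi> = rep_char G e \<sigma>"
    using assms unfolding irr_char_def by auto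
  have \<rho>c: "\<rho> g \<in> carrier_mat d d" and \<sigma>c: "\<sigma> g \<in> carrier_mat e e" if "g \<in> carrier G" for g
    using \<rho> \<sigma> that unfolding is_irr_rep_def is_rep_def by auto
  have \<rho>m: "\<rho> (g \<otimes> h) = \<rho> g * \<rho> h" and \<sigma>m: "\<sigma> (g \<otimes> h) = \<sigma> g * \<sigma> h"
    if "g \<in> carrier G" "h \<in> carrier G" for g h
    using \<rho> \<sigma> that unfolding is_irr_rep_def is_rep_def by auto
  have entry: "(\<Sum>g\<in>carrier G. \<rho> g $$ (k, k) * \<sigma> (inv g) $$ (l, l)) = 0" if kl: "k < d" "l < e" for k l
  proof -
    \<comment> \<open>This is the sum of \<rho>(g) E \<sigma>(inv g), where E is the d by e matrix
      unit at position (k, l).\<close>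
    define Y where "Y = mat d e (\<lambda>(i, j). \<Sum>g\<in>carrier G. \<rho> g $$ (i, k) * \<sigma> (inv g) $$ (l, j))"
    have Yc: "Y \<in> carrier_mat d e" unfolding Y_def by simp
    have "Y = 0\<^sub>m d e"
    proof (rule ccontr)
      assume nz: "Y \<noteq> 0\<^sub>m d e"
      have comm: "\<rho> h * Y = Y * \<sigma> h" if h: "h \<in> carrier G" for h
      proof (rule eq_matI)
        fix i j assume "i < dim_row (Y * \<sigma> h)" "j < dim_col (Y * \<sigma> h)"
        then have ij: "i < d" "j < e" using Yc \<sigma>c[OF h] by auto
        have "(\<rho> h * Y) $$ (i, j) =
          (\<Sum>m<d. \<rho> h $$ (i, m) * (\<Sum>g\<in>carrier G. \<rho> g $$ (m, k) * \<sigma> (inv g) $$ (l, j)))"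
          using ij \<rho>c[OF h] by (auto simp: scalar_prod_def Y_def lessThan_atLeast0 intro!: sum.cong)
        also have "\<dots> = (\<Sum>g\<in>carrier G. (\<Sum>m<d. \<rho> h $$ (i, m) * \<rho> g $$ (m, k)) * \<sigma> (inv g) $$ (l, j))"
          by (simp add: sum_distrib_left sum_distrib_right sum.swap[of _ "{..<d}"] mult.assoc)
        also have "\<dots> = (\<Sum>g\<in>carrier G. \<rho> (h \<otimes> g) $$ (i, k) * \<sigma> (inv g) $$ (l, j))"
          using ij kl \<rho>c \<rho>m h
          by (intro sum.cong refl) (auto simp: scalar_prod_def lessThan_atLeast0 dest!: \<rho>c)
        \<comment> \<open>The second factor is rewritten so that the whole summand depends on
          \<open>g\<close> only through \<open>h \<otimes> g\<close>, ready for reindexing.\<close>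
        also have "\<dots> = (\<Sum>g\<in>carrier G. \<rho> (h \<otimes> g) $$ (i, k) * \<sigma> (inv (h \<otimes> g) \<otimes> h) $$ (l, j))"
          using h by (intro sum.cong refl) (simp add: inv_mult_group m_assoc)
        also have "\<dots> = (\<Sum>g\<in>carrier G. \<rho> g $$ (i, k) * \<sigma> (inv g \<otimes> h) $$ (l, j))"
          by (rule sum.reindex_bij_betw[OF bij_betw_mult_left[OF h]])
        also have "\<dots> = (\<Sum>g\<in>carrier G. \<rho> g $$ (i, k) * (\<Sum>m<e. \<sigma> (inv g) $$ (l, m) * \<sigma> h $$ (m, j)))"
          using ij kl h \<sigma>c[OF inv_closed] \<sigma>c[OF h]
          by (intro sum.cong refl) (auto simp: \<sigma>m scalar_prod_def lessThan_atLeast0 dest!: \<sigma>c[OF inv_closed])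
        also have "\<dots> = (\<Sum>m<e. (\<Sum>g\<in>carrier G. \<rho> g $$ (i, k) * \<sigma> (inv g) $$ (l, m)) * \<sigma> h $$ (m, j))"
          by (simp add: sum_distrib_left sum_distrib_right sum.swap[of _ "{..<e}"] mult.assoc)
        also have "\<dots> = (Y * \<sigma> h) $$ (i, j)"
          using ij \<sigma>c[OF h] by (auto simp: scalar_prod_def Y_def lessThan_atLeast0 intro!: sum.cong)
        finally show "(\<rho> h * Y) $$ (i, j) = (Y * \<sigma> h) $$ (i, j)" .
      qed (use Yc \<rho>c[OF h] \<sigma>c[OF h] in auto)
      have "\<chi> = \<psi>" unfolding \<chi> \<psi> by (rule schur_rep_char_eq[OF \<rho> \<sigma> Yc comm nz])
      with assms(3) show False by simp
    qed
    then have "Y $$ (k, l) = 0" using kl by simp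
    then show ?thesis using kl unfolding Y_def by simp
  qed
  have "(\<Sum>g\<in>carrier G. \<chi> g * \<psi> (inv g)) =
    (\<Sum>g\<in>carrier G. \<Sum>k<d. \<Sum>l<e. \<rho> g $$ (k, k) * \<sigma> (inv g) $$ (l, l))"
    unfolding \<chi> \<psi> rep_char_def by (intro sum.cong refl) (simp add: sum_product)
  also have "\<dots> = (\<Sum>k<d. \<Sum>l<e. \<Sum>g\<in>carrier G. \<rho> g $$ (k, k) * \<sigma> (inv g) $$ (l, l))"
    by (simp add: sum.swap[of _ _ "carrier G"])
  also have "\<dots> = 0" using entry by simp
  finally show ?thesis .
qed

lemma rep_char_conj:
  assumes \<rho>: "is_rep G d \<rho>" and x: "x \<in> carrier G" and g: "g \<in> carrier G"
  shows "rep_char G d \<rho> (x \<otimes> g \<otimes> inv x) = rep_char G d \<rho> g"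
proof -
  have c: "\<rho> g \<in> carrier_mat d d" if "g \<in> carrier G" for g
    using \<rho> that unfolding is_rep_def by auto
  have m: "\<rho> (g \<otimes> h) = \<rho> g * \<rho> h" if "g \<in> carrier G" "h \<in> carrier G" for g h
    using \<rho> that unfolding is_rep_def by auto
  have "(\<Sum>i<d. \<rho> (x \<otimes> g \<otimes> inv x) $$ (i, i)) = (\<Sum>i<d. (\<rho> (x \<otimes> g) * \<rho> (inv x)) $$ (i, i))"
    using x g by (simp add: m)
  also have "\<dots> = (\<Sum>i<d. (\<rho> (inv x) * \<rho> (x \<otimes> g)) $$ (i, i))"
    using x g by (intro trace_mult_swap) (auto intro!: c)
  also have "\<rho> (inv x) * \<rho> (x \<otimes> g) = \<rho> g"
    using x g by (simp add: m[symmetric] m_assoc[symmetric])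
  finally show ?thesis using x g unfolding rep_char_def by simp
qed

text \<open>The sum consists of nonnegative reals, and the term at the identity is the square of the
  positive degree.\<close>

lemma irr_char_norm_nonzero:
  assumes "irr_char G \<chi>" "finite (carrier G)"
  shows "(\<Sum>g\<in>carrier G. \<chi> g * cnj (\<chi> g)) \<noteq> 0"
proof -
  obtain d \<rho> where \<rho>: "is_irr_rep G d \<rho>" and \<chi>: "\<chi> = rep_char G d \<rho>"
    using assms unfolding irr_char_def by auto
  have "\<chi> \<one> \<noteq> 0"
    using \<rho> unfolding \<chi> rep_char_def is_irr_rep_def is_rep_def by simp
  then have "0 < (cmod (\<chi> \<one>))\<^sup>2" by simp
  also have "\<dots> \<le> (\<Sum>g\<in>carrier G. (cmod (\<chi> g))\<^sup>2)"
    using assms(2) by (intro member_le_sum) auto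
  finally have "complex_of_real (\<Sum>g\<in>carrier G. (cmod (\<chi> g))\<^sup>2) \<noteq> 0"
    by (metis of_real_eq_0_iff less_irrefl)
  then show ?thesis unfolding of_real_sum complex_norm_square .
qed

text \<open>The vectors killed by all \<open>B * \<rho> g\<close> form an invariant subspace that
  contains the image of \<open>A\<close>. If it is zero then so is \<open>A\<close>; if it is
  everything, taking \<open>g\<close> to be the identity kills \<open>B\<close>.\<close>

lemma irr_rep_mult_nonzero:
  assumes \<rho>: "is_irr_rep G d \<rho>" and A: "A \<in> carrier_mat d d" and B: "B \<in> carrier_mat d d"
    and 0: "\<And>g. g \<in> carrier G \<Longrightarrow> B * \<rho> g * A = 0\<^sub>m d d"
  shows "A = 0\<^sub>m d d \<or> B = 0\<^sub>m d d"
proof -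
  have c: "\<rho> g \<in> carrier_mat d d" if "g \<in> carrier G" for g
    using \<rho> that unfolding is_irr_rep_def is_rep_def by auto
  have m: "\<rho> (g \<otimes> h) = \<rho> g * \<rho> h" if "g \<in> carrier G" "h \<in> carrier G" for g h
    using \<rho> that unfolding is_irr_rep_def is_rep_def by auto
  define K where "K = {v \<in> carrier_vec d. \<forall>g\<in>carrier G. (B * \<rho> g) *\<^sub>v v = 0\<^sub>v d}"
  have Bc: "B * \<rho> g \<in> carrier_mat d d" if "g \<in> carrier G" for g using c[OF that] B by simp
  have "K = {0\<^sub>v d} \<or> K = carrier_vec d"
  proof (rule is_irr_rep_subspace[OF \<rho>])
    have "M *\<^sub>v 0\<^sub>v d = 0\<^sub>v d" if "M \<in> carrier_mat d d" for M :: "complex mat"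
      using that by (intro eq_vecI) auto
    then show "0\<^sub>v d \<in> K" using Bc unfolding K_def by simp
  next
    fix v w assume "v \<in> K" "w \<in> K"
    then show "v + w \<in> K" using mult_add_distrib_mat_vec[OF Bc] unfolding K_def by auto
  next
    fix a v assume "v \<in> K"
    then show "a \<cdot>\<^sub>v v \<in> K" using mult_mat_vec[OF Bc] unfolding K_def by auto
  next
    fix h v assume h: "h \<in> carrier G" and v: "v \<in> K"
    have "(B * \<rho> g) *\<^sub>v (\<rho> h *\<^sub>v v) = 0\<^sub>v d" if g: "g \<in> carrier G" for g
    proof -
      have vc: "v \<in> carrier_vec d" using v unfolding K_def by simp
      have "(B * \<rho> g) *\<^sub>v (\<rho> h *\<^sub>v v) = (B * \<rho> g * \<rho> h) *\<^sub>v v"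
        by (rule assoc_mult_mat_vec[OF Bc[OF g] c[OF h] vc, symmetric])
      also have "B * \<rho> g * \<rho> h = B * \<rho> (g \<otimes> h)"
        unfolding m[OF g h] by (rule assoc_mult_mat[OF B c[OF g] c[OF h]])
      finally have "(B * \<rho> g) *\<^sub>v (\<rho> h *\<^sub>v v) = (B * \<rho> (g \<otimes> h)) *\<^sub>v v" .
      then show ?thesis using v g h unfolding K_def by auto
    qed
    then show "\<rho> h *\<^sub>v v \<in> K" using v c[OF h] unfolding K_def by auto
  qed (auto simp: K_def)
  then show ?thesis
  proof
    assume K: "K = {0\<^sub>v d}"
    have "A = 0\<^sub>m d d"
    proof (rule mat_eq_0I[OF A])
      fix v :: "complex vec" assume v: "v \<in> carrier_vec d"
      have "(B * \<rho> g) *\<^sub>v (A *\<^sub>v v) = 0\<^sub>v d" if g: "g \<in> carrier G" for g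
        unfolding assoc_mult_mat_vec[OF Bc[OF g] A v, symmetric] 0[OF g]
        using v by (intro eq_vecI) auto
      then have "A *\<^sub>v v \<in> K" using A v unfolding K_def by auto
      then show "A *\<^sub>v v = 0\<^sub>v d" using K by simp
    qed
    then show ?thesis ..
  next
    assume K: "K = carrier_vec d"
    have "\<rho> \<one> = 1\<^sub>m d" using \<rho> unfolding is_irr_rep_def is_rep_def by simp
    then have "B * \<rho> \<one> = B" using B by simp
    moreover have "(B * \<rho> \<one>) *\<^sub>v v = 0\<^sub>v d" if "v \<in> carrier_vec d" for v
    proof -
      have "v \<in> K" using that K by simp
      then show ?thesis unfolding K_def by simp
    qed
    ultimately have "B *\<^sub>v v = 0\<^sub>v d" if "v \<in> carrier_vec d" for v
      using that by simp
    then show ?thesis using mat_eq_0I[OF B] by blast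
  qed
qed

text \<open>Frobenius reciprocity for a class function \<open>f\<close>: invariance lets
  \<open>f\<close> follow the conjugation inside the induced character, so each of the conjugating
  elements contributes the same sum over \<open>H\<close>.\<close>

lemma sum_ind_char_class_fun:
  assumes fin: "finite (carrier G)" and H: "H \<subseteq> carrier G"
    and f: "\<And>x g. x \<in> carrier G \<Longrightarrow> g \<in> carrier G \<Longrightarrow> f (x \<otimes> g \<otimes> inv x) = f g"
  shows "(\<Sum>g\<in>carrier G. ind_char G H \<phi> g * f g) =
    of_nat (card (carrier G)) / of_nat (card H) * (\<Sum>h\<in>H. \<phi> h * f h)"
proof -
  define F where "F g = (if g \<in> H then \<phi> g * f g else 0)" for g
  have "(\<Sum>g\<in>carrier G. ind_char G H \<phi> g * f g) =
    (\<Sum>g\<in>carrier G. 1 / of_nat (card H) * (\<Sum>x\<in>carrier G. F (x \<otimes> g \<otimes> inv x)))"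
    unfolding ind_char_def F_def
    by (intro sum.cong refl) (auto simp: sum_distrib_right f intro!: sum.cong)
  also have "\<dots> = 1 / of_nat (card H) * (\<Sum>x\<in>carrier G. \<Sum>g\<in>carrier G. F (x \<otimes> g \<otimes> inv x))"
    by (subst sum.swap) (simp add: sum_distrib_left)
  also have "\<dots> = 1 / of_nat (card H) * (\<Sum>x\<in>carrier G. \<Sum>g\<in>carrier G. F g)"
    by (simp add: sum.reindex_bij_betw[OF bij_betw_conj])
  also have "(\<Sum>g\<in>carrier G. F g) = (\<Sum>h\<in>H. \<phi> h * f h)"
    unfolding F_def using fin H by (simp add: sum.If_cases Int_absorb1)
  finally show ?thesis by simp
qed

lemma ind_char_conj:
  assumes x: "x \<in> carrier G" and g: "g \<in> carrier G"
  shows "ind_char G H \<phi> (x \<otimes> g \<otimes> inv x) = ind_char G H \<phi> g"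
proof -
  define F where "F g = (if g \<in> H then \<phi> g else 0)" for g
  have bij: "bij_betw (\<lambda>y. y \<otimes> x) (carrier G) (carrier G)"
    using x by (intro bij_betwI[where g = "\<lambda>y. y \<otimes> inv x"]) (auto simp: m_assoc)
  have "(\<Sum>y\<in>carrier G. F (y \<otimes> (x \<otimes> g \<otimes> inv x) \<otimes> inv y)) =
    (\<Sum>y\<in>carrier G. F ((y \<otimes> x) \<otimes> g \<otimes> inv (y \<otimes> x)))"
    using x g by (intro sum.cong refl) (simp add: inv_mult_group m_assoc)
  also have "\<dots> = (\<Sum>y\<in>carrier G. F (y \<otimes> g \<otimes> inv y))"
    by (rule sum.reindex_bij_betw[OF bij])
  finally show ?thesis using x g unfolding ind_char_def F_def by simp
qed

end

section \<open>Young diagrams and the dominance order\<close>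

text \<open>The cell \<open>(i, j)\<close> is in row \<open>i\<close> and column \<open>j\<close>, counted from \<open>0\<close>.\<close>

definition young_diagram :: "nat \<Rightarrow> (nat \<times> nat) set \<Rightarrow> bool" where
  "young_diagram n Y \<longleftrightarrow> finite Y \<and> card Y = n \<and>
     (\<forall>i j i' j'. (i, j) \<in> Y \<longrightarrow> i' \<le> i \<longrightarrow> j' \<le> j \<longrightarrow> (i', j') \<in> Y)"

definition row_sum :: "(nat \<times> nat) set \<Rightarrow> nat \<Rightarrow> nat" where
  "row_sum Y k = card {c \<in> Y. fst c < k}"

definition dominates :: "(nat \<times> nat) set \<Rightarrow> (nat \<times> nat) set \<Rightarrow> bool" where
  "dominates Z Y \<longleftrightarrow> (\<forall>k. row_sum Y k \<le> row_sum Z k)"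

lemma down_closed_eq_lessThan:
  fixes R :: "nat set"
  assumes fin: "finite R" and down: "\<And>i j. j \<in> R \<Longrightarrow> i \<le> j \<Longrightarrow> i \<in> R"
  shows "R = {..<card R}"
proof (rule card_subset_eq)
  show "R \<subseteq> {..<card R}"
  proof
    fix j assume "j \<in> R"
    then have "{..j} \<subseteq> R" using down by auto
    then have "card {..j} \<le> card R" by (rule card_mono[OF fin])
    then show "j \<in> {..<card R}" by simp
  qed
qed auto

lemma finite_young_diagrams: "finite {Y. young_diagram n Y}"
proof (rule finite_subset)
  show "{Y. young_diagram n Y} \<subseteq> Pow ({..<n} \<times> {..<n})"
  proof (clarsimp)
    fix Y i j assume Y: "young_diagram n Y" and ij: "(i, j) \<in> Y"
    have fin: "finite Y" and n: "card Y = n" using Y unfolding young_diagram_def by auto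
    have "{..i} \<times> {0} \<subseteq> Y" "{0} \<times> {..j} \<subseteq> Y"
      using Y ij unfolding young_diagram_def by blast+
    then have "card ({..i} \<times> {0::nat}) \<le> n" "card ({0::nat} \<times> {..j}) \<le> n"
      using card_mono[OF fin] n by metis+
    then show "i < n \<and> j < n" by (simp add: card_cartesian_product)
  qed
qed simp

text \<open>Row \<open>i\<close> is an initial segment whose length is a difference of consecutive
  partial sums. Hence \<open>row_sum\<close> determines the diagram, which is what makes dominance
  antisymmetric.\<close>

lemma mem_young_diagram_iff:
  assumes Y: "young_diagram n Y"
  shows "(i, j) \<in> Y \<longleftrightarrow> j < row_sum Y (Suc i) - row_sum Y i"
proof -
  have fin: "finite Y" using Y unfolding young_diagram_def by auto
  define R where "R = {j. (i, j) \<in> Y}"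
  have R: "Pair i ` R = {c \<in> Y. fst c = i}" unfolding R_def by auto
  have "finite (Pair i ` R)" unfolding R using fin by simp
  then have finR: "finite R" by (rule finite_imageD) (simp add: inj_on_def)
  have "R = {..<card R}"
    by (rule down_closed_eq_lessThan[OF finR]) (use Y in \<open>auto simp: R_def young_diagram_def\<close>)
  moreover have "row_sum Y (Suc i) = row_sum Y i + card R"
  proof -
    have "{c \<in> Y. fst c < Suc i} = {c \<in> Y. fst c < i} \<union> Pair i ` R"
      unfolding R by auto
    moreover have "{c \<in> Y. fst c < i} \<inter> Pair i ` R = {}" by auto
    moreover have "card (Pair i ` R) = card R" by (rule card_image) (simp add: inj_on_def)
    ultimately show ?thesis
      unfolding row_sum_def using fin finR by (simp add: card_Un_disjoint)
  qed
  ultimately show ?thesis unfolding R_def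
    by (metis diff_add_inverse lessThan_iff mem_Collect_eq)
qed

lemma dominates_antisym:
  assumes "young_diagram n Y" "young_diagram n Z" "dominates Y Z" "dominates Z Y"
  shows "Y = Z"
proof -
  have "row_sum Y = row_sum Z" using assms(3,4) unfolding dominates_def by (auto intro: antisym)
  then have "(i, j) \<in> Y \<longleftrightarrow> (i, j) \<in> Z" for i j
    using mem_young_diagram_iff[OF assms(1)] mem_young_diagram_iff[OF assms(2)] by simp
  then show ?thesis by auto
qed

lemma dominates_trans: "dominates Z Y \<Longrightarrow> dominates Y W \<Longrightarrow> dominates Z W"
  unfolding dominates_def using order_trans by blast

text \<open>The inequality compares column by column: at most \<open>k\<close> points of a column have
  \<open>r x < k\<close>, and a column of the diagram is an initial segment.\<close>

lemma dominates_of_inj: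
  assumes Y: "bij_betw e X Y" and Zd: "young_diagram n Z" and Z: "bij_betw e' X Z"
    and inj: "inj_on (\<lambda>x. (fst (e x), snd (e' x))) X"
  shows "dominates Z Y"
  unfolding dominates_def
proof
  fix k
  have finZ: "finite Z" using Zd unfolding young_diagram_def by auto
  then have finX: "finite X" using Z bij_betw_finite by blast
  let ?S = "{x \<in> X. fst (e x) < k}"
  let ?T = "{c \<in> Z. fst c < k}"
  have "row_sum Y k = card ?S"
  proof -
    have "bij_betw e ?S {c \<in> Y. fst c < k}"
      using Y unfolding bij_betw_def by (auto simp: inj_on_def)
    then show ?thesis unfolding row_sum_def by (simp add: bij_betw_same_card)
  qed
  also have "\<dots> = (\<Sum>j\<in>snd ` Z. card {x \<in> ?S. snd (e' x) = j})"
    using Z by (subst card_eq_sum, subst sum.group[symmetric, where T = "snd ` Z" and g = "\<lambda>x. snd (e' x)"])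
      (auto simp: finX finZ bij_betw_def)
  also have "\<dots> \<le> (\<Sum>j\<in>snd ` Z. card {c \<in> ?T. snd c = j})"
  proof (rule sum_mono)
    fix j
    define C where "C = {i. (i, j) \<in> Z}"
    have ZC: "{c \<in> Z. snd c = j} = (\<lambda>i. (i, j)) ` C" unfolding C_def by auto
    have injC: "inj_on (\<lambda>i. (i, j)) A" for A by (simp add: inj_on_def)
    have "finite {c \<in> Z. snd c = j}" using finZ by simp
    then have finC: "finite C" unfolding ZC using injC finite_imageD by blast
    have C: "C = {..<card C}"
      by (rule down_closed_eq_lessThan[OF finC]) (use Zd in \<open>auto simp: C_def young_diagram_def\<close>)
    have "{c \<in> ?T. snd c = j} = (\<lambda>i. (i, j)) ` (C \<inter> {..<k})" unfolding C_def by auto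
    then have "card {c \<in> ?T. snd c = j} = card (C \<inter> {..<k})"
      by (simp add: card_image[OF injC])
    also have "C \<inter> {..<k} = {..<min (card C) k}" by (subst C) auto
    finally have T: "card {c \<in> ?T. snd c = j} = min (card C) k" by simp
    have "card {x \<in> ?S. snd (e' x) = j} \<le> card {..<k}"
      by (rule card_inj_on_le[where f = "\<lambda>x. fst (e x)"]) (use inj in \<open>auto simp: inj_on_def\<close>)
    moreover have "card {x \<in> ?S. snd (e' x) = j} \<le> card {c \<in> Z. snd c = j}"
      by (rule card_inj_on_le[where f = e']) (use Z finZ in \<open>auto simp: bij_betw_def inj_on_def\<close>)
    moreover have "card {c \<in> Z. snd c = j} = card C" unfolding ZC by (rule card_image[OF injC])
    ultimately show "card {x \<in> ?S. snd (e' x) = j} \<le> card {c \<in> ?T. snd c = j}"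
      unfolding T by simp
  qed
  also have "\<dots> = card ?T"
    by (subst (2) card_eq_sum, subst sum.group[symmetric, where T = "snd ` Z" and g = snd])
      (auto simp: finZ)
  finally show "row_sum Y k \<le> row_sum Z k" unfolding row_sum_def[of Z] .
qed

lemma young_diagram_swap:
  assumes "young_diagram n Y" shows "young_diagram n (prod.swap ` Y)"
proof -
  have "card (prod.swap ` Y) = card Y" by (rule card_image) simp
  moreover have "(i, j) \<in> prod.swap ` Y \<longleftrightarrow> (j, i) \<in> Y" for i j by force
  ultimately show ?thesis using assms unfolding young_diagram_def by (metis finite_imageI)
qed

text \<open>The fibres become the rows, listed by decreasing size so that the result is closed
  downwards. A point goes to the pair of the index of its fibre and its position inside the
  fibre.\<close>

lemma ex_young_diagram_fibres:
  assumes fin: "finite X"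
  shows "\<exists>Y e. young_diagram (card X) Y \<and> bij_betw e X Y \<and>
    (\<forall>x\<in>X. \<forall>y\<in>X. fst (e x) = fst (e y) \<longleftrightarrow> r x = r y)"
proof -
  define F where "F s = {x \<in> X. r x = s}" for s
  have finF: "finite (F s)" for s using fin unfolding F_def by simp
  obtain bs' where bs': "set bs' = r ` X" "distinct bs'"
    using finite_distinct_list[of "r ` X"] fin by auto
  \<comment> \<open>\<open>sort_key\<close> sorts in ascending order, so the negated size puts the
    largest fibre first.\<close>
  define bs where "bs = sort_key (\<lambda>s. - int (card (F s))) bs'"
  have bs: "set bs = r ` X" "distinct bs" unfolding bs_def using bs' by auto
  have mono: "card (F (bs ! i)) \<le> card (F (bs ! i'))" if "i' \<le> i" "i < length bs" for i i'
    using sorted_nth_mono[OF sorted_sort_key, of i' i "\<lambda>s. - int (card (F s))" bs'] that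
    by (simp flip: bs_def)
  have "\<exists>h. bij_betw h (F s) {0..<card (F s)}" for s
    by (rule ex_bij_betw_finite_nat[OF finF])
  then obtain h where h: "\<And>s. bij_betw (h s) (F s) {0..<card (F s)}" by metis
  have nth: "bij_betw ((!) bs) {..<length bs} (r ` X)"
    by (rule bij_betw_nth) (use bs in auto)
  define idx where "idx = the_inv_into {..<length bs} ((!) bs)"
  have idx: "bij_betw idx (r ` X) {..<length bs}"
    unfolding idx_def by (rule bij_betw_the_inv_into[OF nth])
  have idx_nth: "bs ! idx s = s" if "s \<in> r ` X" for s
    unfolding idx_def using that nth by (rule f_the_inv_into_f_bij_betw[rotated])
  have nth_idx: "idx (bs ! i) = i" if "i < length bs" for i
    unfolding idx_def using that nth by (simp add: bij_betw_def the_inv_into_f_f)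
  define e where "e x = (idx (r x), h (r x) x)" for x
  have same: "fst (e x) = fst (e y) \<longleftrightarrow> r x = r y" if "x \<in> X" "y \<in> X" for x y
    using that idx unfolding e_def bij_betw_def inj_on_def by auto
  have inj: "inj_on e X"
  proof (rule inj_onI)
    fix x y assume xy: "x \<in> X" "y \<in> X" "e x = e y"
    have "r x = r y" using same[OF xy(1,2)] xy(3) by simp
    then show "x = y"
      using xy h[of "r y"] unfolding e_def F_def bij_betw_def inj_on_def by auto
  qed
  have image: "(i, j) \<in> e ` X \<longleftrightarrow> i < length bs \<and> j < card (F (bs ! i))" for i j
  proof
    assume "(i, j) \<in> e ` X"
    then obtain x where x: "x \<in> X" "i = idx (r x)" "j = h (r x) x" unfolding e_def by auto
    have "x \<in> F (r x)" using x unfolding F_def by simp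
    then have "j < card (F (r x))" using h[of "r x"] x unfolding bij_betw_def by auto
    then show "i < length bs \<and> j < card (F (bs ! i))"
      using x idx idx_nth unfolding bij_betw_def by auto
  next
    assume ij: "i < length bs \<and> j < card (F (bs ! i))"
    then have "j \<in> h (bs ! i) ` F (bs ! i)" using h[of "bs ! i"] unfolding bij_betw_def by auto
    then obtain x where "x \<in> X" "r x = bs ! i" "j = h (bs ! i) x" unfolding F_def by auto
    then show "(i, j) \<in> e ` X" using nth_idx ij unfolding e_def by force
  qed
  have "young_diagram (card X) (e ` X)"
    unfolding young_diagram_def using fin
  proof (intro conjI allI impI)
    fix i j i' j' assume "(i, j) \<in> e ` X" "i' \<le> i" "j' \<le> j"
    then show "(i', j') \<in> e ` X" unfolding image using mono[of i' i] by auto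
  qed (use fin in \<open>simp_all add: card_image[OF inj]\<close>)
  then show ?thesis using inj same by (meson inj_on_imp_bij_betw)
qed

section \<open>Orbits and conjugacy of permutations\<close>

text \<open>Forward iterates already give the full orbit for the permutations considered here: each
  point returns to itself after finitely many steps.\<close>

definition orb :: "('a \<Rightarrow> 'a) \<Rightarrow> 'a \<Rightarrow> 'a set" where
  "orb p x = range (\<lambda>i. (p ^^ i) x)"

lemma orb_self: "x \<in> orb p x"
  unfolding orb_def by (metis funpow_0 rangeI)

lemma orb_eqI:
  assumes p: "permutation p" and y: "y \<in> orb p x"
  shows "orb p y = orb p x"
proof -
  have sub: "orb p b \<subseteq> orb p a" if "b \<in> orb p a" for a b
  proof -
    obtain i where i: "b = (p ^^ i) a" using \<open>b \<in> orb p a\<close> unfolding orb_def by auto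
    have "(p ^^ k) b = (p ^^ (k + i)) a" for k unfolding i funpow_add by simp
    then show ?thesis unfolding orb_def by auto
  qed
  obtain i where i: "y = (p ^^ i) x" using y unfolding orb_def by auto
  define m where "m = least_power p x"
  have m: "m > 0" unfolding m_def by (rule least_power_of_permutation(2)[OF p])
  \<comment> \<open>From \<open>y\<close>, which is \<open>i\<close> steps after \<open>x\<close>,
    this many further steps complete \<open>i\<close> full periods and lead back to
    \<open>x\<close>.\<close>
  have "(p ^^ (m * i - i)) y = (p ^^ (m * i - i + i)) x" unfolding i funpow_add by simp
  also have "m * i - i + i = m * i" using m by simp
  also have "(p ^^ (m * i)) x = x" using least_power_dvd[OF p, of x "m * i"] unfolding m_def by simp
  finally have "x \<in> orb p y" unfolding orb_def by (metis rangeI)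
  then show ?thesis using sub y by blast
qed

lemma card_orb:
  assumes p: "permutation p" shows "card (orb p x) = least_power p x"
proof -
  have "orb p x = set (support p x)" unfolding orb_def using support_set[OF p] by simp
  then show ?thesis using cycle_of_permutation[OF p, of x] distinct_card by fastforce
qed

text \<open>Equality of two iterates at \<open>a\<close> means that the period divides the
  difference of the exponents, and the period is the size of the orbit, which \<open>p\<close> and
  \<open>q\<close> share.\<close>

lemma funpow_eq_transfer:
  assumes p: "permutation p" and q: "permutation q" and eq: "orb p a = orb q a"
    and pij: "(p ^^ i) a = (p ^^ j) a"
  shows "(q ^^ i) a = (q ^^ j) a"
proof -
  have lp: "least_power p a = least_power q a"
    using card_orb[OF p, of a] card_orb[OF q, of a] eq by simp
  have *: "(q ^^ i) a = (q ^^ j) a" if pij: "(p ^^ i) a = (p ^^ j) a" and ij: "i \<le> j" for i j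
  proof -
    have dec: "(f ^^ j) a = (f ^^ i) ((f ^^ (j - i)) a)" for f :: "'a \<Rightarrow> 'a"
    proof -
      have "(f ^^ j) a = (f ^^ (i + (j - i))) a" using ij by simp
      then show ?thesis unfolding funpow_add by simp
    qed
    have "inj p" using p by (simp add: permutation_bijective bij_is_inj)
    then have "inj (p ^^ i)" by (rule inj_fn)
    then have "(p ^^ (j - i)) a = a" using pij dec[of p] by (metis injD)
    then have "least_power p a dvd j - i" using least_power_dvd[OF p] by blast
    then have "(q ^^ (j - i)) a = a" using least_power_dvd[OF q] lp by metis
    then show ?thesis using dec[of q] by simp
  qed
  show ?thesis using *[of i j] *[of j i] pij by (metis nat_le_linear)
qed

text \<open>In each orbit a base point is fixed, and its k-th iterate under \<open>p\<close> is sent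
  to its k-th iterate under \<open>q\<close>. \<open>funpow_eq_transfer\<close> makes this
  independent of the exponent, and, applied from \<open>q\<close> to \<open>p\<close>,
  injective.\<close>

lemma conj_if_same_orbits:
  assumes fin: "finite X" and p: "p permutes X" and q: "q permutes X"
    and eq: "\<And>x. orb p x = orb q x"
  shows "\<exists>s. s permutes X \<and> s \<circ> p = q \<circ> s"
proof -
  have pp: "permutation p" and qp: "permutation q"
    using fin p q permutation_permutes by blast+
  \<comment> \<open>The choice depends on \<open>x\<close> only through the set
    \<open>orb p x\<close>, so all points of an orbit receive the same base point.\<close>
  define c where "c x = (SOME y. y \<in> orb p x)" for x
  have c_orb: "c x \<in> orb p x" for x unfolding c_def by (rule someI[of "\<lambda>y. y \<in> orb p x", OF orb_self])
  have orb_c: "orb p (c x) = orb p x" for x by (rule orb_eqI[OF pp c_orb])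
  have c_eq: "c x = c y" if "orb p x = orb p y" for x y unfolding c_def that ..
  define k where "k x = (SOME k. (p ^^ k) (c x) = x)" for x
  have k: "(p ^^ k x) (c x) = x" for x
  proof -
    have "x \<in> orb p (c x)" unfolding orb_c by (rule orb_self)
    then obtain k where "x = (p ^^ k) (c x)" unfolding orb_def by auto
    then have "(p ^^ k) (c x) = x" by simp
    then show ?thesis unfolding k_def by (rule someI)
  qed
  define s where "s x = (q ^^ k x) (c x)" for x
  have s_orb: "s x \<in> orb p x" for x
  proof -
    have "s x \<in> orb q (c x)" unfolding s_def orb_def by (rule rangeI)
    then show ?thesis using eq[of "c x"] orb_c[of x] by simp
  qed
  have "s (p x) = q (s x)" for x
  proof -
    have "(p ^^ 1) x \<in> orb p x" unfolding orb_def by (rule rangeI)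
    then have "p x \<in> orb p x" by simp
    then have "orb p (p x) = orb p x" by (rule orb_eqI[OF pp])
    then have c: "c (p x) = c x" by (rule c_eq)
    have "(p ^^ k (p x)) (c x) = (p ^^ Suc (k x)) (c x)"
      using k[of "p x"] k[of x] unfolding c by simp
    then have "(q ^^ k (p x)) (c x) = (q ^^ Suc (k x)) (c x)"
      by (rule funpow_eq_transfer[OF pp qp eq])
    then show ?thesis unfolding s_def c by simp
  qed
  then have comm: "s \<circ> p = q \<circ> s" by auto
  have inj: "inj s"
  proof (rule injI)
    fix x y assume xy: "s x = s y"
    have "orb p x = orb p y"
      using orb_eqI[OF pp s_orb[of x]] orb_eqI[OF pp s_orb[of y]] xy by simp
    then have c: "c x = c y" by (rule c_eq)
    then have "(p ^^ k x) (c x) = (p ^^ k y) (c x)"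
      using xy unfolding s_def
      by (intro funpow_eq_transfer[OF qp pp eq[symmetric]]) simp
    then show "x = y" unfolding k unfolding c k .
  qed
  have orb_out: "orb p x = {x}" if "x \<notin> X" for x
  proof -
    have "(p ^^ i) x = x" for i
      by (induction i) (use p that in \<open>auto simp: permutes_not_in\<close>)
    then show ?thesis unfolding orb_def by auto
  qed
  have "s x = x" if "x \<notin> X" for x using s_orb[of x] orb_out[OF that] by simp
  moreover have "s ` X \<subseteq> X"
  proof (rule image_subsetI, rule ccontr)
    fix x assume x: "x \<in> X" and "s x \<notin> X"
    then have "orb p x = {s x}" using orb_out orb_eqI[OF pp s_orb[of x]] by simp
    then show False using x \<open>s x \<notin> X\<close> orb_self[of x p] by simp
  qed
  then have "bij_betw s X X"
    using endo_inj_surj[OF fin] inj by (metis bij_betw_def inj_on_subset subset_UNIV)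
  ultimately have "s permutes X" by (metis bij_imp_permutes)
  then show ?thesis using comm by blast
qed

lemma orb_subset:
  assumes p: "permutation p" and h: "\<And>x. orb p (h x) = orb p x"
  shows "orb h x \<subseteq> orb p x"
proof -
  have "orb p ((h ^^ i) x) = orb p x" for i
    by (induction i) (simp_all add: h)
  then have "(h ^^ i) x \<in> orb p x" for i using orb_self[of "(h ^^ i) x" p] by simp
  then show ?thesis unfolding orb_def[of h] by auto
qed

lemma finite_orb: "permutation p \<Longrightarrow> finite (orb p x)"
  using card_orb[of p x] least_power_of_permutation(2)[of p x] card.infinite by fastforce

section \<open>Young subgroups\<close>

declare One_nat_def [simp del] \<comment> \<open>it would rewrite \<open>{1..n}\<close> to \<open>{Suc 0..n}\<close>\<close>

text \<open>The flag selects the sign or the trivial character, so that row and column characters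
  share one development.\<close>

definition sign_char :: "bool \<Rightarrow> (nat \<Rightarrow> nat) \<Rightarrow> complex" where
  "sign_char b p = (if b then of_int (sign p) else 1)"

text \<open>The fibres of \<open>r\<close> partition \<open>{1..n}\<close>, and \<open>fibre_group n r\<close> is the Young subgroup of this
  partition.\<close>

definition fibre_group :: "nat \<Rightarrow> (nat \<Rightarrow> 'b) \<Rightarrow> (nat \<Rightarrow> nat) set" where
  "fibre_group n r = {p. p permutes {1..n} \<and> (\<forall>x. r (p x) = r x)}"

text \<open>The inducing function is restricted to the subgroup because \<open>linear_char\<close>
  asks for equality with a \<open>rep_char\<close>, which is restricted in the same way.\<close>

definition fibre_char :: "nat \<Rightarrow> bool \<Rightarrow> (nat \<Rightarrow> 'b) \<Rightarrow> (nat \<Rightarrow> nat) \<Rightarrow> complex" where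
  "fibre_char n b r =
     ind_char (sym_group n) (fibre_group n r) (\<lambda>p\<in>fibre_group n r. sign_char b p)"

section \<open>Rules for the sign, Young subgroups and the characters induced from them\<close>

lemma permutes_comp_inv:
  assumes "x permutes S" "g permutes S"
  shows "x \<circ> g \<circ> inv' x permutes S"
  using assms by (intro permutes_compose permutes_inv)

lemma sign_char_id [simp]: "sign_char b id = 1"
  unfolding sign_char_def by simp

lemma sign_char_square [simp]: "sign_char b p * sign_char b p = 1"
  unfolding sign_char_def by (simp flip: of_int_mult)

lemma sign_char_left_square [simp]: "sign_char b p * (sign_char b p * z) = z"
  by (simp add: mult.assoc[symmetric])

lemma cnj_sign_char [simp]: "cnj (sign_char b p) = sign_char b p"
  unfolding sign_char_def by simp

lemma sign_char_comp:
  assumes "p permutes {1..n}" "q permutes {1..n}"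
  shows "sign_char b (p \<circ> q) = sign_char b p * sign_char b q"
  using assms permutes_imp_permutation[of "{1..n}"]
  unfolding sign_char_def by (simp add: sign_compose)

lemma sign_char_inv:
  assumes "p permutes {1..n}"
  shows "sign_char b (inv' p) = sign_char b p"
  using assms permutes_imp_permutation[of "{1..n}"]
  unfolding sign_char_def by (simp add: sign_inverse)

lemma sign_char_conj:
  assumes "x permutes {1..n}" "g permutes {1..n}"
  shows "sign_char b (x \<circ> g \<circ> inv' x) = sign_char b g"
proof -
  have "sign_char b (x \<circ> g \<circ> inv' x) = sign_char b x * sign_char b g * sign_char b x"
    using assms
    by (simp add: sign_char_comp[of _ n] sign_char_inv[of _ n] permutes_compose permutes_inv)
  then show ?thesis by (simp add: mult.commute)
qed

lemma finite_permutes_interval [simp]: "finite {p. p permutes {1..n::nat}}"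
  by (rule finite_permutations) simp

lemma finite_fibre_group [simp]: "finite (fibre_group n r)"
  unfolding fibre_group_def by (rule finite_subset[OF _ finite_permutes_interval[of n]]) auto

lemma id_in_fibre_group [simp]: "id \<in> fibre_group n r"
  unfolding fibre_group_def by (simp add: permutes_id)

lemma card_fibre_group_nonzero [simp]: "card (fibre_group n r) \<noteq> 0"
proof -
  have "fibre_group n r \<noteq> {}" using id_in_fibre_group by blast
  then show ?thesis by simp
qed

lemma fibre_group_permutes: "p \<in> fibre_group n r \<Longrightarrow> p permutes {1..n}"
  unfolding fibre_group_def by simp

lemma carrier_sym_group: "carrier (sym_group n) = {p. p permutes {1..n}}"
  unfolding sym_group_def by simp

lemma subgroup_fibre_group: "subgroup (fibre_group n r) (sym_group n)"
proof (rule group.subgroupI[OF sym_group_is_group])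
  fix p assume p: "p \<in> fibre_group n r"
  then have perm: "p permutes {1..n}" by (rule fibre_group_permutes)
  have "r (inv' p x) = r x" for x
    using p permutes_inverses(1)[OF perm, of x] unfolding fibre_group_def
    by (metis (mono_tags, lifting) mem_Collect_eq)
  then show "inv\<^bsub>sym_group n\<^esub> p \<in> fibre_group n r"
    using perm by (simp add: carrier_sym_group fibre_group_def permutes_inv)
qed (auto simp: fibre_group_def sym_group_def permutes_compose intro: permutes_id)

lemma linear_char_fibre_group:
  "linear_char (sym_group n\<lparr>carrier := fibre_group n r\<rparr>) (\<lambda>p\<in>fibre_group n r. sign_char b p)"
  unfolding linear_char_def
proof (intro exI[of _ "\<lambda>p. mat 1 1 (\<lambda>_. sign_char b p)"] conjI)
  show "is_rep (sym_group n\<lparr>carrier := fibre_group n r\<rparr>) 1 (\<lambda>p. mat 1 1 (\<lambda>_. sign_char b p))"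
    unfolding is_rep_def
    by (auto simp: sym_group_def sign_char_comp[of _ n] scalar_prod_def fibre_group_permutes
        intro!: eq_matI)
qed (auto simp: rep_char_def intro!: restrict_ext)

text \<open>The sign is constant on conjugacy classes, so every nonzero term carries the sign of
  \<open>g\<close> itself. This exposes the sign twist between the two flags and shows that the
  values are real.\<close>

lemma fibre_char_eq:
  assumes g: "g permutes {1..n}"
  shows "fibre_char n b r g = 1 / of_nat (card (fibre_group n r)) *
    (\<Sum>x | x permutes {1..n}. if x \<circ> g \<circ> inv' x \<in> fibre_group n r then sign_char b g else 0)"
  using g unfolding fibre_char_def ind_char_def
  by (auto simp: carrier_sym_group sym_group_mult sign_char_conj[of _ n] intro!: sum.cong)

lemma fibre_char_conj:
  assumes "x permutes {1..n}" "g permutes {1..n}"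
  shows "fibre_char n b r (x \<circ> g \<circ> inv' x) = fibre_char n b r g"
  using group.ind_char_conj[OF sym_group_is_group, of x n g] assms
  by (simp add: carrier_sym_group sym_group_mult fibre_char_def)

lemma fibre_char_sign:
  assumes "g permutes {1..n}"
  shows "fibre_char n b r g = sign_char b g * fibre_char n False r g"
  unfolding fibre_char_eq[OF assms]
  by (auto simp: sum_distrib_left sign_char_def intro!: sum.cong)

lemma cnj_fibre_char:
  assumes "g permutes {1..n}"
  shows "cnj (fibre_char n b r g) = fibre_char n b r g"
  unfolding fibre_char_eq[OF assms] by (auto intro!: sum.cong)

lemma conj_in_fibre_group_iff:
  assumes p: "p permutes {1..n}" and g: "g permutes {1..n}"
  shows "p \<circ> g \<circ> inv' p \<in> fibre_group n r \<longleftrightarrow> g \<in> fibre_group n (\<lambda>x. r (p x))"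
proof -
  have "(\<forall>y. r (p (g (inv' p y))) = r y) \<longleftrightarrow> (\<forall>x. r (p (g x)) = r (p x))"
    by (metis permutes_inverses[OF p])
  then show ?thesis
    using p g unfolding fibre_group_def by (simp add: permutes_comp_inv)
qed

lemma fibre_group_cong:
  assumes "\<And>x y. x \<in> {1..n} \<Longrightarrow> y \<in> {1..n} \<Longrightarrow> r x = r y \<longleftrightarrow> r' x = r' y"
  shows "fibre_group n r = fibre_group n r'"
proof -
  have "r (p x) = r x \<longleftrightarrow> r' (p x) = r' x" if p: "p permutes {1..n}" for p x
  proof (cases "x \<in> {1..n}")
    case True
    then show ?thesis using assms p by (simp only: permutes_in_image)
  next
    case False
    then show ?thesis using p by (simp add: permutes_not_in)
  qed
  then show ?thesis unfolding fibre_group_def by auto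
qed

lemma bij_betw_permutes_conj:
  assumes p: "p permutes S"
  shows "bij_betw (\<lambda>g. p \<circ> g \<circ> inv' p) {g. g permutes S} {g. g permutes S}"
proof (rule bij_betwI[where g = "\<lambda>g. inv' p \<circ> g \<circ> p"])
  show "(\<lambda>g. p \<circ> g \<circ> inv' p) \<in> {g. g permutes S} \<rightarrow> {g. g permutes S}"
    using p by (auto intro: permutes_comp_inv)
  show "(\<lambda>g. inv' p \<circ> g \<circ> p) \<in> {g. g permutes S} \<rightarrow> {g. g permutes S}"
    using p by (auto intro!: permutes_compose permutes_inv)
qed (auto simp: fun_eq_iff permutes_inverses[OF p])

text \<open>Relabelling the points by \<open>p\<close> conjugates the Young subgroup, and the
  substitution of \<open>p \<circ> x\<close> for \<open>x\<close> absorbs the conjugation.\<close>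

lemma fibre_char_compose:
  assumes p: "p permutes {1..n}" and g: "g permutes {1..n}"
  shows "fibre_char n b (\<lambda>x. r (p x)) g = fibre_char n b r g"
proof -
  have iff: "p \<circ> (x \<circ> g \<circ> inv' x) \<circ> inv' p \<in> fibre_group n r \<longleftrightarrow>
      x \<circ> g \<circ> inv' x \<in> fibre_group n (\<lambda>x. r (p x))" if "x permutes {1..n}" for x
    using that by (intro conj_in_fibre_group_iff p permutes_comp_inv g)
  have eq: "(p \<circ> x) \<circ> g \<circ> inv' (p \<circ> x) = p \<circ> (x \<circ> g \<circ> inv' x) \<circ> inv' p"
    if "x permutes {1..n}" for x
    using that p by (simp add: o_inv_distrib permutes_bij comp_assoc)
  have inj: "inj_on (\<lambda>g. p \<circ> g \<circ> inv' p) {g. g permutes {1..n}}"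
    using bij_betw_permutes_conj[OF p] by (rule bij_betw_imp_inj_on)
  have image: "(\<lambda>g. p \<circ> g \<circ> inv' p) ` fibre_group n (\<lambda>x. r (p x)) = fibre_group n r"
  proof
    show "(\<lambda>g. p \<circ> g \<circ> inv' p) ` fibre_group n (\<lambda>x. r (p x)) \<subseteq> fibre_group n r"
      using conj_in_fibre_group_iff[OF p, of _ r] fibre_group_permutes by blast
    show "fibre_group n r \<subseteq> (\<lambda>g. p \<circ> g \<circ> inv' p) ` fibre_group n (\<lambda>x. r (p x))"
    proof
      fix h assume h: "h \<in> fibre_group n r"
      then obtain k where k: "k permutes {1..n}" "h = p \<circ> k \<circ> inv' p"
        using bij_betw_permutes_conj[OF p] fibre_group_permutes[OF h] unfolding bij_betw_def by blast
      then have "k \<in> fibre_group n (\<lambda>x. r (p x))"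
        using h conj_in_fibre_group_iff[OF p k(1), of r] by simp
      then show "h \<in> (\<lambda>g. p \<circ> g \<circ> inv' p) ` fibre_group n (\<lambda>x. r (p x))"
        unfolding k(2) by (rule imageI)
    qed
  qed
  have "bij_betw (\<lambda>g. p \<circ> g \<circ> inv' p) (fibre_group n (\<lambda>x. r (p x))) (fibre_group n r)"
    unfolding bij_betw_def image
    by (rule conjI[OF inj_on_subset[OF inj] refl]) (auto simp: fibre_group_permutes)
  then have card: "card (fibre_group n (\<lambda>x. r (p x))) = card (fibre_group n r)"
    by (rule bij_betw_same_card)
  have bij: "bij_betw (\<lambda>x. p \<circ> x) {x. x permutes {1..n}} {x. x permutes {1..n}}"
    by (rule bij_betwI[where g = "\<lambda>x. inv' p \<circ> x"])
      (use p in \<open>auto simp: permutes_compose permutes_inv fun_eq_iff permutes_inverses\<close>)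
  have "(\<Sum>x | x permutes {1..n}. if x \<circ> g \<circ> inv' x \<in> fibre_group n r then sign_char b g else 0) =
    (\<Sum>x | x permutes {1..n}. if (p \<circ> x) \<circ> g \<circ> inv' (p \<circ> x) \<in> fibre_group n r then sign_char b g else 0)"
    by (rule sum.reindex_bij_betw[OF bij, symmetric])
  also have "\<dots> = (\<Sum>x | x permutes {1..n}.
      if x \<circ> g \<circ> inv' x \<in> fibre_group n (\<lambda>x. r (p x)) then sign_char b g else 0)"
    by (intro sum.cong refl) (simp only: eq iff mem_Collect_eq)
  finally show ?thesis unfolding fibre_char_eq[OF g] card by simp
qed

text \<open>Subgroups are closed under inverses and the sign is invariant. Through the expansions,
  this replaces the inverse in Schur orthogonality by the element itself.\<close>

lemma fibre_char_inverse:
  assumes g: "g permutes {1..n}"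
  shows "fibre_char n b r (inv' g) = fibre_char n b r g"
proof -
  have "x \<circ> inv' g \<circ> inv' x \<in> fibre_group n r \<longleftrightarrow> x \<circ> g \<circ> inv' x \<in> fibre_group n r"
    if x: "x permutes {1..n}" for x
  proof -
    have closed: "inv' h \<in> fibre_group n r" if "h \<in> fibre_group n r" for h
      using subgroup.m_inv_closed[OF subgroup_fibre_group that] fibre_group_permutes[OF that]
      by (simp add: carrier_sym_group)
    have "inv' (x \<circ> g \<circ> inv' x) = x \<circ> inv' g \<circ> inv' x"
      using x g by (simp add: o_inv_distrib permutes_bij permutes_inv[THEN permutes_bij] bij_comp inv_inv_eq comp_assoc)
    moreover from this have "inv' (x \<circ> inv' g \<circ> inv' x) = x \<circ> g \<circ> inv' x"
      using x g by (metis inv_inv_eq permutes_bij permutes_comp_inv)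
    ultimately show ?thesis using closed by metis
  qed
  then show ?thesis
    unfolding fibre_char_eq[OF g] fibre_char_eq[OF permutes_inv[OF g]] sign_char_inv[OF g]
    by simp
qed

lemma sum_fibre_char_class_fun:
  assumes "\<And>x g. x permutes {1..n} \<Longrightarrow> g permutes {1..n} \<Longrightarrow> f (x \<circ> g \<circ> inv' x) = f g"
  shows "(\<Sum>g | g permutes {1..n}. fibre_char n b r g * f g) =
    fact n / of_nat (card (fibre_group n r)) * (\<Sum>h\<in>fibre_group n r. sign_char b h * f h)"
proof -
  have "(\<Sum>g\<in>carrier (sym_group n). fibre_char n b r g * f g) =
    of_nat (card (carrier (sym_group n))) / of_nat (card (fibre_group n r)) *
    (\<Sum>h\<in>fibre_group n r. (\<lambda>p\<in>fibre_group n r. sign_char b p) h * f h)"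
    unfolding fibre_char_def
    by (rule group.sum_ind_char_class_fun[OF sym_group_is_group])
      (auto simp: carrier_sym_group sym_group_mult fibre_group_permutes assms)
  then show ?thesis unfolding sym_group_card_carrier by (simp add: carrier_sym_group)
qed

text \<open>Two points in one fibre give a transposition in the group, and multiplication by it is a
  bijection that reverses the sign. Otherwise the group is trivial.\<close>

lemma sum_sign_fibre_group:
  "(\<Sum>h\<in>fibre_group n r. sign_char True h) = (if inj_on r {1..n} then 1 else 0)"
proof (cases "inj_on r {1..n}")
  case True
  have "fibre_group n r = {id}"
  proof -
    have "p x = x" if "p \<in> fibre_group n r" for p x
    proof (cases "x \<in> {1..n}")
      case x: True
      then have "p x \<in> {1..n}" using fibre_group_permutes[OF that] by (simp only: permutes_in_image)
      then show ?thesis using True x that unfolding fibre_group_def inj_on_def by blast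
    next
      case False
      then show ?thesis using fibre_group_permutes[OF that] by (simp add: permutes_not_in)
    qed
    then show ?thesis using id_in_fibre_group[of n r] by (auto simp: fun_eq_iff)
  qed
  then show ?thesis using True by simp
next
  case False
  then obtain x y where xy: "x \<in> {1..n}" "y \<in> {1..n}" "x \<noteq> y" "r x = r y"
    unfolding inj_on_def by auto
  define t where "t = transpose x y"
  have t: "t permutes {1..n}" unfolding t_def using xy by (intro permutes_swap_id) auto
  have rt: "r (t z) = r z" for z unfolding t_def transpose_def using xy by auto
  have tt: "t \<circ> (t \<circ> p) = p" for p unfolding t_def by (simp add: fun_eq_iff)
  have in_t: "t \<circ> h \<in> fibre_group n r" if "h \<in> fibre_group n r" for h
    using that rt t unfolding fibre_group_def by (auto simp: permutes_compose)
  have bij: "bij_betw (\<lambda>h. t \<circ> h) (fibre_group n r) (fibre_group n r)"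
    by (rule bij_betwI[where g = "\<lambda>h. t \<circ> h"]) (use in_t tt in auto)
  have "sign_char True t = -1"
    unfolding t_def sign_char_def using xy by (simp add: sign_swap_id)
  then have neg: "sign_char True (t \<circ> h) = - sign_char True h" if "h \<in> fibre_group n r" for h
    using sign_char_comp[OF t fibre_group_permutes[OF that], of True] by simp
  have "(\<Sum>h\<in>fibre_group n r. sign_char True h) = (\<Sum>h\<in>fibre_group n r. sign_char True (t \<circ> h))"
    by (rule sum.reindex_bij_betw[OF bij, symmetric])
  also have "\<dots> = - (\<Sum>h\<in>fibre_group n r. sign_char True h)"
    by (simp add: neg sum_negf)
  finally show ?thesis using False by simp
qed

text \<open>After Frobenius reciprocity, each \<open>x\<close> contributes the signed sum over the
  intersection of one Young subgroup with a conjugate of the other. That intersection is the Young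
  subgroup of the common refinement of the two partitions, so the contribution is 1 if all parts of
  the refinement are singletons and 0 otherwise.\<close>

lemma sum_fibre_char_mult:
  "(\<Sum>g | g permutes {1..n}. fibre_char n False r g * fibre_char n True r' g) =
    fact n / (of_nat (card (fibre_group n r)) * of_nat (card (fibre_group n r'))) *
    of_nat (card {p. p permutes {1..n} \<and> inj_on (\<lambda>x. (r x, r' (p x))) {1..n}})"
proof -
  have inner: "(\<Sum>h\<in>fibre_group n r. if x \<circ> h \<circ> inv' x \<in> fibre_group n r' then sign_char True h else 0) =
    (if inj_on (\<lambda>z. (r z, r' (x z))) {1..n} then 1 else 0 :: complex)" if x: "x permutes {1..n}" for x
  proof -
    have "(\<Sum>h\<in>fibre_group n r. if x \<circ> h \<circ> inv' x \<in> fibre_group n r' then sign_char True h else 0) =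
      (\<Sum>h\<in>fibre_group n r. if h \<in> fibre_group n (\<lambda>z. r' (x z)) then sign_char True h else 0)"
      by (intro sum.cong refl if_cong conj_in_fibre_group_iff[OF x] fibre_group_permutes)
    also have "\<dots> = (\<Sum>h\<in>fibre_group n r \<inter> fibre_group n (\<lambda>z. r' (x z)). sign_char True h)"
      by (simp add: sum.inter_restrict)
    also have "fibre_group n r \<inter> fibre_group n (\<lambda>z. r' (x z)) = fibre_group n (\<lambda>z. (r z, r' (x z)))"
      unfolding fibre_group_def by auto
    finally show ?thesis unfolding sum_sign_fibre_group .
  qed
  have "(\<Sum>g | g permutes {1..n}. fibre_char n False r g * fibre_char n True r' g) =
    fact n / of_nat (card (fibre_group n r)) * (\<Sum>h\<in>fibre_group n r. fibre_char n True r' h)"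
    by (subst sum_fibre_char_class_fun) (simp_all add: fibre_char_conj sign_char_def)
  also have "(\<Sum>h\<in>fibre_group n r. fibre_char n True r' h) =
    (\<Sum>h\<in>fibre_group n r. 1 / of_nat (card (fibre_group n r')) *
      (\<Sum>x | x permutes {1..n}. if x \<circ> h \<circ> inv' x \<in> fibre_group n r' then sign_char True h else 0))"
    by (intro sum.cong refl fibre_char_eq fibre_group_permutes)
  also have "\<dots> = 1 / of_nat (card (fibre_group n r')) * (\<Sum>x | x permutes {1..n}. \<Sum>h\<in>fibre_group n r.
      if x \<circ> h \<circ> inv' x \<in> fibre_group n r' then sign_char True h else 0)"
    by (subst sum.swap) (simp add: sum_distrib_left)
  also have "(\<Sum>x | x permutes {1..n}. \<Sum>h\<in>fibre_group n r.
      if x \<circ> h \<circ> inv' x \<in> fibre_group n r' then sign_char True h else 0) =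
    (\<Sum>x | x permutes {1..n}. if inj_on (\<lambda>z. (r z, r' (x z))) {1..n} then 1 else 0)"
    by (intro sum.cong refl inner) simp
  also have "\<dots> = of_nat (card {p. p permutes {1..n} \<and> inj_on (\<lambda>x. (r x, r' (p x))) {1..n}})"
    by (simp add: sum.inter_filter[symmetric])
  finally show ?thesis by simp
qed

section \<open>Symmetrizers in an irreducible representation\<close>

text \<open>The image under \<rho> of the group algebra element with coefficients \<open>s\<close>
  on \<open>H\<close>: a symmetrizer for the trivial character, an antisymmetrizer for the
  sign.\<close>

definition sum_mat :: "nat \<Rightarrow> ('a \<Rightarrow> complex mat) \<Rightarrow> ('a \<Rightarrow> complex) \<Rightarrow> 'a set \<Rightarrow> complex mat" where
  "sum_mat d \<rho> s H = mat d d (\<lambda>(i, j). \<Sum>h\<in>H. s h * \<rho> h $$ (i, j))"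

lemma sum_mat_carrier [simp]: "sum_mat d \<rho> s H \<in> carrier_mat d d"
  unfolding sum_mat_def by simp

context group
begin

text \<open>Translation by \<open>t\<close> permutes \<open>H\<close>. The factor that comes out is
  the inverse of \<open>s t\<close>, which is \<open>s t\<close> itself by
  \<open>tt\<close>.\<close>

lemma rep_mult_sum_mat:
  assumes rep: "is_rep G d \<rho>" and H: "subgroup H G" and t: "t \<in> H"
    and s: "\<And>x y. x \<in> H \<Longrightarrow> y \<in> H \<Longrightarrow> s (x \<otimes> y) = s x * s y" and tt: "s t * s t = 1"
  shows "\<rho> t * sum_mat d \<rho> s H = s t \<cdot>\<^sub>m sum_mat d \<rho> s H"
    and "sum_mat d \<rho> s H * \<rho> t = s t \<cdot>\<^sub>m sum_mat d \<rho> s H"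
proof -
  have c: "\<rho> g \<in> carrier_mat d d" if "g \<in> H" for g
    using rep subgroup.mem_carrier[OF H that] unfolding is_rep_def by auto
  have m: "\<rho> (g \<otimes> h) = \<rho> g * \<rho> h" if "g \<in> H" "h \<in> H" for g h
    using rep subgroup.mem_carrier[OF H] that unfolding is_rep_def by auto
  note HG = subgroup.mem_carrier[OF H] and closed = subgroup.m_closed[OF H] subgroup.m_inv_closed[OF H]
  have left: "bij_betw (\<lambda>h. t \<otimes> h) H H"
    by (rule bij_betwI[where g = "\<lambda>h. inv t \<otimes> h"]) (use t in \<open>auto simp: closed HG inv_mult_cancel\<close>)
  have right: "bij_betw (\<lambda>h. h \<otimes> t) H H"
    by (rule bij_betwI[where g = "\<lambda>h. h \<otimes> inv t"]) (use t in \<open>auto simp: closed HG m_assoc\<close>)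
  have sl: "s h = s t * s (t \<otimes> h)" and sr: "s h = s t * s (h \<otimes> t)" if "h \<in> H" for h
    using that t s tt by (simp_all add: mult.assoc[symmetric])
  show "\<rho> t * sum_mat d \<rho> s H = s t \<cdot>\<^sub>m sum_mat d \<rho> s H"
  proof (rule eq_matI)
    fix i j assume "i < dim_row (s t \<cdot>\<^sub>m sum_mat d \<rho> s H)" "j < dim_col (s t \<cdot>\<^sub>m sum_mat d \<rho> s H)"
    then have ij: "i < d" "j < d" unfolding sum_mat_def by auto
    have "(\<rho> t * sum_mat d \<rho> s H) $$ (i, j) = (\<Sum>k<d. \<rho> t $$ (i, k) * (\<Sum>h\<in>H. s h * \<rho> h $$ (k, j)))"
      using ij c[OF t] by (auto simp: scalar_prod_def sum_mat_def lessThan_atLeast0 intro!: sum.cong)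
    also have "\<dots> = (\<Sum>h\<in>H. s h * (\<Sum>k<d. \<rho> t $$ (i, k) * \<rho> h $$ (k, j)))"
      by (simp add: sum_distrib_left sum.swap[of _ "H"] mult_ac)
    also have "\<dots> = (\<Sum>h\<in>H. s t * (s (t \<otimes> h) * \<rho> (t \<otimes> h) $$ (i, j)))"
    proof (rule sum.cong[OF refl])
      fix h assume h: "h \<in> H"
      have "(\<Sum>k<d. \<rho> t $$ (i, k) * \<rho> h $$ (k, j)) = \<rho> (t \<otimes> h) $$ (i, j)"
        using ij c[OF t] c[OF h] by (simp add: m[OF t h] scalar_prod_def lessThan_atLeast0)
      then show "s h * (\<Sum>k<d. \<rho> t $$ (i, k) * \<rho> h $$ (k, j)) =
          s t * (s (t \<otimes> h) * \<rho> (t \<otimes> h) $$ (i, j))"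
        using sl[OF h] by simp
    qed
    also have "\<dots> = s t * (\<Sum>h\<in>H. s h * \<rho> h $$ (i, j))"
      unfolding sum_distrib_left[symmetric]
      by (subst sum.reindex_bij_betw[OF left]) (rule refl)
    finally show "(\<rho> t * sum_mat d \<rho> s H) $$ (i, j) = (s t \<cdot>\<^sub>m sum_mat d \<rho> s H) $$ (i, j)"
      using ij unfolding sum_mat_def by simp
  qed (use c[OF t] in \<open>auto simp: sum_mat_def\<close>)
  show "sum_mat d \<rho> s H * \<rho> t = s t \<cdot>\<^sub>m sum_mat d \<rho> s H"
  proof (rule eq_matI)
    fix i j assume "i < dim_row (s t \<cdot>\<^sub>m sum_mat d \<rho> s H)" "j < dim_col (s t \<cdot>\<^sub>m sum_mat d \<rho> s H)"
    then have ij: "i < d" "j < d" unfolding sum_mat_def by auto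
    have "(sum_mat d \<rho> s H * \<rho> t) $$ (i, j) = (\<Sum>k<d. (\<Sum>h\<in>H. s h * \<rho> h $$ (i, k)) * \<rho> t $$ (k, j))"
      using ij c[OF t] by (auto simp: scalar_prod_def sum_mat_def lessThan_atLeast0 intro!: sum.cong)
    also have "\<dots> = (\<Sum>h\<in>H. s h * (\<Sum>k<d. \<rho> h $$ (i, k) * \<rho> t $$ (k, j)))"
      by (simp add: sum_distrib_left sum_distrib_right sum.swap[of _ "H"] mult_ac)
    also have "\<dots> = (\<Sum>h\<in>H. s t * (s (h \<otimes> t) * \<rho> (h \<otimes> t) $$ (i, j)))"
    proof (rule sum.cong[OF refl])
      fix h assume h: "h \<in> H"
      have "(\<Sum>k<d. \<rho> h $$ (i, k) * \<rho> t $$ (k, j)) = \<rho> (h \<otimes> t) $$ (i, j)"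
        using ij c[OF t] c[OF h] by (simp add: m[OF h t] scalar_prod_def lessThan_atLeast0)
      then show "s h * (\<Sum>k<d. \<rho> h $$ (i, k) * \<rho> t $$ (k, j)) =
          s t * (s (h \<otimes> t) * \<rho> (h \<otimes> t) $$ (i, j))"
        using sr[OF h] by simp
    qed
    also have "\<dots> = s t * (\<Sum>h\<in>H. s h * \<rho> h $$ (i, j))"
      unfolding sum_distrib_left[symmetric]
      by (subst sum.reindex_bij_betw[OF right]) (rule refl)
    finally show "(sum_mat d \<rho> s H * \<rho> t) $$ (i, j) = (s t \<cdot>\<^sub>m sum_mat d \<rho> s H) $$ (i, j)"
      using ij unfolding sum_mat_def by simp
  qed (use c[OF t] in \<open>auto simp: sum_mat_def\<close>)
qed

end

lemma irr_char_class_fun: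
  assumes "irr_char (sym_group n) \<chi>" "x permutes {1..n}" "g permutes {1..n}"
  shows "\<chi> (x \<circ> g \<circ> inv' x) = \<chi> g"
proof -
  obtain d \<rho> where "is_rep (sym_group n) d \<rho>" "\<chi> = rep_char (sym_group n) d \<rho>"
    using assms(1) unfolding irr_char_def is_irr_rep_def by auto
  then show ?thesis
    using group.rep_char_conj[OF sym_group_is_group, of n d \<rho> x g] assms(2,3)
    by (simp add: carrier_sym_group sym_group_mult)
qed

text \<open>The trace of this matrix is the sum of the sign character times \<chi> over the Young
  subgroup, which Frobenius reciprocity identifies with the given pairing up to a factor.\<close>

lemma sum_mat_nonzero:
  assumes \<rho>: "is_irr_rep (sym_group n) d \<rho>" and \<chi>: "\<chi> = rep_char (sym_group n) d \<rho>"
    and nz: "(\<Sum>g | g permutes {1..n}. fibre_char n b r g * \<chi> g) \<noteq> 0"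
  shows "sum_mat d \<rho> (sign_char b) (fibre_group n r) \<noteq> 0\<^sub>m d d"
proof
  assume 0: "sum_mat d \<rho> (sign_char b) (fibre_group n r) = 0\<^sub>m d d"
  have "irr_char (sym_group n) \<chi>" using \<rho> \<chi> unfolding irr_char_def by auto
  then have "(\<Sum>h\<in>fibre_group n r. sign_char b h * \<chi> h) \<noteq> 0"
    using nz irr_char_class_fun by (subst (asm) sum_fibre_char_class_fun) auto
  also have "(\<Sum>h\<in>fibre_group n r. sign_char b h * \<chi> h) =
    (\<Sum>h\<in>fibre_group n r. \<Sum>i<d. sign_char b h * \<rho> h $$ (i, i))"
    unfolding \<chi> rep_char_def
    by (intro sum.cong refl) (simp add: carrier_sym_group fibre_group_permutes sum_distrib_left)
  also have "\<dots> = (\<Sum>i<d. sum_mat d \<rho> (sign_char b) (fibre_group n r) $$ (i, i))"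
    unfolding sum_mat_def by (subst sum.swap) simp
  also have "\<dots> = 0" unfolding 0 by simp
  finally show False by simp
qed

text \<open>A transposition \<open>t\<close> of the fibre group of \<open>r\<close> whose conjugate by \<open>g\<close> is in that of \<open>r'\<close> fixes
  the symmetrizer \<open>A\<close> and negates the antisymmetrizer \<open>B\<close>, so it forces \<open>B * \<rho> g * A = 0\<close>.
  Irreducibility provides a \<open>g\<close> for which this product is nonzero.\<close>

lemma irr_char_fibre_inj:
  assumes irr: "irr_char (sym_group n) \<chi>"
    and row: "(\<Sum>g | g permutes {1..n}. fibre_char n False r g * \<chi> g) \<noteq> 0"
    and col: "(\<Sum>g | g permutes {1..n}. fibre_char n True r' g * \<chi> g) \<noteq> 0"
  shows "\<exists>p. p permutes {1..n} \<and> inj_on (\<lambda>x. (r x, r' (p x))) {1..n}"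
proof -
  interpret group "sym_group n" by (rule sym_group_is_group)
  obtain d \<rho> where \<rho>: "is_irr_rep (sym_group n) d \<rho>" and \<chi>: "\<chi> = rep_char (sym_group n) d \<rho>"
    using irr unfolding irr_char_def by auto
  have rep: "is_rep (sym_group n) d \<rho>" using \<rho> unfolding is_irr_rep_def by simp
  have c: "\<rho> g \<in> carrier_mat d d" if "g permutes {1..n}" for g
    using rep that unfolding is_rep_def by (simp add: carrier_sym_group)
  have m: "\<rho> (g \<circ> h) = \<rho> g * \<rho> h" if "g permutes {1..n}" "h permutes {1..n}" for g h
    using rep that unfolding is_rep_def by (simp add: carrier_sym_group sym_group_mult)
  define A where "A = sum_mat d \<rho> (sign_char False) (fibre_group n r)"
  define B where "B = sum_mat d \<rho> (sign_char True) (fibre_group n r')"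
  have Ac: "A \<in> carrier_mat d d" and Bc: "B \<in> carrier_mat d d" unfolding A_def B_def by simp_all
  have "A \<noteq> 0\<^sub>m d d" "B \<noteq> 0\<^sub>m d d"
    unfolding A_def B_def using sum_mat_nonzero[OF \<rho> \<chi>] row col by auto
  then obtain g where g: "g permutes {1..n}" and nz: "B * \<rho> g * A \<noteq> 0\<^sub>m d d"
    using irr_rep_mult_nonzero[OF \<rho> Ac Bc] by (auto simp: carrier_sym_group)
  have "inj_on (\<lambda>x. (r x, r' (g x))) {1..n}"
  proof (rule ccontr)
    assume "\<not> inj_on (\<lambda>x. (r x, r' (g x))) {1..n}"
    then obtain x y where xy: "x \<in> {1..n}" "y \<in> {1..n}" "x \<noteq> y" "r x = r y" "r' (g x) = r' (g y)"
      unfolding inj_on_def by auto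
    define t where "t = transpose x y"
    define u where "u = transpose (g x) (g y)"
    have gxy: "g x \<in> {1..n}" "g y \<in> {1..n}" "g x \<noteq> g y"
      using xy permutes_in_image[OF g] permutes_inj[OF g] by (auto dest: injD)
    have tp: "t permutes {1..n}" unfolding t_def using xy by (intro permutes_swap_id)
    have up: "u permutes {1..n}" unfolding u_def using gxy by (intro permutes_swap_id)
    have t: "t \<in> fibre_group n r"
      using tp xy unfolding fibre_group_def by (auto simp: t_def transpose_def)
    have u: "u \<in> fibre_group n r'"
      using up xy unfolding fibre_group_def by (auto simp: u_def transpose_def)
    have comm: "u \<circ> g = g \<circ> t"
      using permutes_inj[OF g] unfolding u_def t_def by (auto simp: fun_eq_iff transpose_def dest: injD)
    have sign_u: "sign_char True u = -1"
      unfolding u_def sign_char_def using gxy by (simp add: sign_swap_id)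
    have tA: "\<rho> t * A = A"
    proof -
      have "\<rho> t * A = sign_char False t \<cdot>\<^sub>m A" unfolding A_def
        by (rule rep_mult_sum_mat(1)[OF rep subgroup_fibre_group t])
          (simp_all add: sign_char_comp[of _ n] sym_group_mult fibre_group_permutes)
      then show ?thesis using Ac by (auto simp: sign_char_def)
    qed
    have Bu: "B * \<rho> u = - B"
    proof -
      have "B * \<rho> u = sign_char True u \<cdot>\<^sub>m B" unfolding B_def
        by (rule rep_mult_sum_mat(2)[OF rep subgroup_fibre_group u])
          (simp_all add: sign_char_comp[of _ n] sym_group_mult fibre_group_permutes)
      then show ?thesis unfolding sign_u using Bc by (auto intro!: eq_matI)
    qed
    have "B * \<rho> g * A = B * \<rho> g * (\<rho> t * A)" unfolding tA ..
    also have "\<dots> = B * \<rho> g * \<rho> t * A"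
      by (rule assoc_mult_mat[symmetric]) (use Ac Bc c[OF g] c[OF tp] in auto)
    also have "B * \<rho> g * \<rho> t = B * (\<rho> g * \<rho> t)"
      by (rule assoc_mult_mat[OF Bc c[OF g] c[OF tp]])
    also have "\<rho> g * \<rho> t = \<rho> u * \<rho> g" unfolding m[OF g tp, symmetric] m[OF up g, symmetric] comm ..
    also have "B * (\<rho> u * \<rho> g) = B * \<rho> u * \<rho> g"
      by (rule assoc_mult_mat[OF Bc c[OF up] c[OF g], symmetric])
    also have "\<dots> * A = - (B * \<rho> g * A)"
      unfolding Bu using Ac Bc c[OF g] by simp
    finally have neg: "B * \<rho> g * A = - (B * \<rho> g * A)" .
    have "B * \<rho> g * A = 0\<^sub>m d d"
    proof (rule eq_matI)
      fix i j assume "i < dim_row (0\<^sub>m d d :: complex mat)" "j < dim_col (0\<^sub>m d d :: complex mat)"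
      then have ij: "i < d" "j < d" by auto
      have "(B * \<rho> g * A) $$ (i, j) = (- (B * \<rho> g * A)) $$ (i, j)"
        by (rule arg_cong[OF neg])
      also have "\<dots> = - (B * \<rho> g * A) $$ (i, j)"
        by (rule index_uminus_mat) (use ij Ac Bc in auto)
      finally show "(B * \<rho> g * A) $$ (i, j) = 0\<^sub>m d d $$ (i, j)" using ij by simp
    qed (use Ac Bc in auto)
    then show False using nz by simp
  qed
  then show ?thesis using g by blast
qed

section \<open>Class functions as combinations of induced characters\<close>

text \<open>Agreement is required on the carrier only: characters are restricted functions, whose
  unspecified value elsewhere a linear combination need not reproduce.\<close>

definition in_span :: "nat \<Rightarrow> 'i set \<Rightarrow> ('i \<Rightarrow> (nat \<Rightarrow> nat) \<Rightarrow> complex) \<Rightarrow>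
    ((nat \<Rightarrow> nat) \<Rightarrow> complex) \<Rightarrow> bool" where
  "in_span n I F f \<longleftrightarrow> (\<exists>c. \<forall>g. g permutes {1..n} \<longrightarrow> f g = (\<Sum>i\<in>I. c i * F i g))"

lemma in_span_cong:
  assumes "in_span n I F f" "\<And>g. g permutes {1..n} \<Longrightarrow> f g = f' g"
  shows "in_span n I F f'"
  using assms unfolding in_span_def by metis

lemma in_span_lincomb:
  assumes "finite K" "\<And>k. k \<in> K \<Longrightarrow> in_span n I F (f k)"
  shows "in_span n I F (\<lambda>g. \<Sum>k\<in>K. a k * f k g)"
proof -
  obtain c where c: "\<And>k g. k \<in> K \<Longrightarrow> g permutes {1..n} \<Longrightarrow> f k g = (\<Sum>i\<in>I. c k i * F i g)"
    using assms(2) unfolding in_span_def by metis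
  have "(\<Sum>k\<in>K. a k * f k g) = (\<Sum>i\<in>I. (\<Sum>k\<in>K. a k * c k i) * F i g)" if "g permutes {1..n}" for g
  proof -
    have "(\<Sum>k\<in>K. a k * f k g) = (\<Sum>k\<in>K. \<Sum>i\<in>I. a k * c k i * F i g)"
      using c that by (intro sum.cong refl) (simp add: sum_distrib_left mult.assoc)
    also have "\<dots> = (\<Sum>i\<in>I. (\<Sum>k\<in>K. a k * c k i) * F i g)"
      by (subst sum.swap) (simp add: sum_distrib_right)
    finally show ?thesis .
  qed
  then show ?thesis unfolding in_span_def by (intro exI[of _ "\<lambda>i. \<Sum>k\<in>K. a k * c k i"]) blast
qed

lemma in_span_member:
  assumes "finite I" "i \<in> I" "\<And>g. g permutes {1..n} \<Longrightarrow> f g = F i g"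
  shows "in_span n I F f"
  unfolding in_span_def
proof (intro exI[of _ "\<lambda>k. if k = i then 1 else 0"] allI impI)
  fix g assume "g permutes {1..n}"
  then show "f g = (\<Sum>k\<in>I. (if k = i then 1 else 0) * F k g)"
    using assms by (simp add: if_distrib[of "\<lambda>z. z * _"] cong: if_cong)
qed

text \<open>Up to the order of the centralizer of \<open>h\<close>, this is the indicator function of its conjugacy
  class.\<close>

definition conj_count :: "nat \<Rightarrow> (nat \<Rightarrow> nat) \<Rightarrow> (nat \<Rightarrow> nat) \<Rightarrow> complex" where
  "conj_count n h g = (\<Sum>x | x permutes {1..n}. if x \<circ> g \<circ> inv' x = h then 1 else 0)"

lemma conj_count_conj:
  assumes s: "s permutes {1..n}" and h: "s \<circ> h = h' \<circ> s"
  shows "conj_count n h g = conj_count n h' g"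
proof -
  have bij: "bij_betw (\<lambda>x. s \<circ> x) {x. x permutes {1..n}} {x. x permutes {1..n}}"
    by (rule bij_betwI[where g = "\<lambda>x. inv' s \<circ> x"])
      (use s in \<open>auto simp: permutes_compose permutes_inv fun_eq_iff permutes_inverses\<close>)
  have h': "h' = s \<circ> h \<circ> inv' s"
    unfolding h using permutes_inverses[OF s] by (simp add: fun_eq_iff)
  have iff: "(s \<circ> x) \<circ> g \<circ> inv' (s \<circ> x) = h' \<longleftrightarrow> x \<circ> g \<circ> inv' x = h"
    if x: "x permutes {1..n}" for x
  proof -
    have "(s \<circ> x) \<circ> g \<circ> inv' (s \<circ> x) = s \<circ> (x \<circ> g \<circ> inv' x) \<circ> inv' s"
      using s x by (simp add: o_inv_distrib permutes_bij comp_assoc)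
    moreover have "s \<circ> k \<circ> inv' s = s \<circ> l \<circ> inv' s \<longleftrightarrow> k = l" for k l
    proof
      assume eq: "s \<circ> k \<circ> inv' s = s \<circ> l \<circ> inv' s"
      have "inv' s ((s \<circ> k \<circ> inv' s) (s z)) = inv' s ((s \<circ> l \<circ> inv' s) (s z))" for z
        unfolding eq ..
      then show "k = l" using permutes_inverses[OF s] by (simp add: fun_eq_iff)
    qed simp
    ultimately show ?thesis unfolding h' by simp
  qed
  have "conj_count n h' g =
    (\<Sum>x | x permutes {1..n}. if (s \<circ> x) \<circ> g \<circ> inv' (s \<circ> x) = h' then 1 else 0)"
    unfolding conj_count_def by (rule sum.reindex_bij_betw[OF bij, symmetric])
  also have "\<dots> = conj_count n h g"
    unfolding conj_count_def by (intro sum.cong refl) (simp add: iff)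
  finally show ?thesis by simp
qed

lemma fibre_char_eq_sum_conj_count:
  assumes g: "g permutes {1..n}"
  shows "of_nat (card (fibre_group n r)) * fibre_char n False r g = (\<Sum>h\<in>fibre_group n r. conj_count n h g)"
proof -
  have "(\<Sum>h\<in>fibre_group n r. conj_count n h g) =
    (\<Sum>x | x permutes {1..n}. \<Sum>h\<in>fibre_group n r. if x \<circ> g \<circ> inv' x = h then 1 else 0)"
    unfolding conj_count_def by (rule sum.swap)
  also have "\<dots> = (\<Sum>x | x permutes {1..n}. if x \<circ> g \<circ> inv' x \<in> fibre_group n r then 1 else 0)"
    by (intro sum.cong refl) simp
  finally show ?thesis unfolding fibre_char_eq[OF g] sign_char_def by simp
qed

text \<open>Let \<open>H\<close> be the Young subgroup of the orbit partition of \<open>h\<close>. The elements of \<open>H\<close> whose orbits are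
  those of \<open>h\<close> are conjugate to \<open>h\<close>, and all the others have smaller orbits.\<close>

lemma conj_count_in_span:
  assumes F: "\<And>r :: nat \<Rightarrow> nat set. in_span n I F (fibre_char n False r)"
    and "h permutes {1..n}"
  shows "in_span n I F (conj_count n h)"
  using assms(2)
\<comment> \<open>The measure is the sum of the squares of the orbit sizes in \<open>{1..n}\<close>;
  it drops when all orbits shrink weakly and one shrinks properly.\<close>
proof (induction "\<Sum>x\<in>{1..n}. card (orb h x)" arbitrary: h rule: less_induct)
  case less
  note h = less.prems
  have perm: "permutation p" if "p permutes {1..n}" for p
    using that permutes_imp_permutation[of "{1..n}"] by simp
  define H where "H = fibre_group n (orb h)"
  define H1 where "H1 = {k \<in> H. \<forall>x. orb k x = orb h x}"
  define H2 where "H2 = {k \<in> H. \<not> (\<forall>x. orb k x = orb h x)}"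
  have Hp: "k permutes {1..n}" if "k \<in> H" for k using that unfolding H_def by (rule fibre_group_permutes)
  have fin: "finite H" unfolding H_def by simp
  have h1: "h \<in> H1"
  proof -
    have "orb h (h x) = orb h x" for x
    proof (rule orb_eqI[OF perm[OF h]])
      have "(h ^^ Suc 0) x \<in> orb h x" unfolding orb_def by (rule rangeI)
      then show "h x \<in> orb h x" by simp
    qed
    then show ?thesis using h unfolding H1_def H_def fibre_group_def by simp
  qed
  have 1: "conj_count n k g = conj_count n h g" if "k \<in> H1" for k g
  proof -
    have k: "k permutes {1..n}" "\<And>x. orb k x = orb h x" using that Hp unfolding H1_def by auto
    then obtain s where "s permutes {1..n}" "s \<circ> k = h \<circ> s"
      using conj_if_same_orbits[OF _ k(1) h k(2)] by auto
    then show ?thesis by (rule conj_count_conj)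
  qed
  have 2: "in_span n I F (conj_count n k)" if "k \<in> H2" for k
  proof -
    have k: "k permutes {1..n}" and kH: "k \<in> H" using that Hp unfolding H2_def by auto
    have sub: "orb k x \<subseteq> orb h x" for x
      using kH unfolding H_def fibre_group_def by (intro orb_subset perm h) auto
    have "\<exists>x. orb k x \<noteq> orb h x" using that unfolding H2_def by auto
    then obtain x where x: "orb k x \<noteq> orb h x" ..
    have "x \<in> {1..n}"
    proof (rule ccontr)
      assume "x \<notin> {1..n}"
      then have "(h ^^ i) x = x" for i
        by (induction i) (use permutes_not_in[OF h] in auto)
      then have "orb h x = {x}" unfolding orb_def by auto
      then show False using sub[of x] x orb_self[of x k] by auto
    qed
    moreover have "card (orb k y) \<le> card (orb h y)" for y
      by (rule card_mono[OF finite_orb[OF perm[OF h]] sub])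
    moreover have "card (orb k x) < card (orb h x)"
      using sub x by (intro psubset_card_mono finite_orb perm h) auto
    ultimately have "(\<Sum>x\<in>{1..n}. card (orb k x)) < (\<Sum>x\<in>{1..n}. card (orb h x))"
      by (intro sum_strict_mono_ex1) auto
    then show ?thesis using k by (rule less.hyps)
  qed
  have span2: "in_span n I F (\<lambda>g. \<Sum>k\<in>H2. 1 * conj_count n k g)"
    by (rule in_span_lincomb) (use fin 2 in \<open>auto simp: H2_def\<close>)
  \<comment> \<open>The relation between the Young character and the sums over \<open>H1\<close> and
    \<open>H2\<close> is solved for \<open>conj_count n h\<close>. The two booleans index the two
    terms of the solution.\<close>
  let ?f = "\<lambda>j::bool. if j then fibre_char n False (orb h) else (\<lambda>g. \<Sum>k\<in>H2. 1 * conj_count n k g)"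
  let ?a = "\<lambda>j. if j then of_nat (card H) / of_nat (card H1) else - 1 / of_nat (card H1) :: complex"
  have "in_span n I F (\<lambda>g. \<Sum>j\<in>UNIV. ?a j * ?f j g)"
    by (rule in_span_lincomb) (use F span2 in auto)
  then show ?case
  proof (rule in_span_cong)
    fix g assume g: "g permutes {1..n}"
    have "H = H1 \<union> H2" "H1 \<inter> H2 = {}" unfolding H1_def H2_def by auto
    then have "(\<Sum>k\<in>H. conj_count n k g) = (\<Sum>k\<in>H1. conj_count n k g) + (\<Sum>k\<in>H2. conj_count n k g)"
      using fin by (metis sum.union_disjoint finite_Un)
    also have "(\<Sum>k\<in>H1. conj_count n k g) = of_nat (card H1) * conj_count n h g"
      using 1 by simp
    finally have "of_nat (card H1) * conj_count n h g =
        of_nat (card H) * fibre_char n False (orb h) g - (\<Sum>k\<in>H2. conj_count n k g)"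
      using fibre_char_eq_sum_conj_count[OF g, of "orb h"] unfolding H_def by simp
    moreover have "of_nat (card H1) \<noteq> (0 :: complex)"
      using h1 fin unfolding H1_def by auto
    ultimately show "(\<Sum>j\<in>UNIV. ?a j * ?f j g) = conj_count n h g"
      by (simp add: UNIV_bool field_simps)
  qed
qed

text \<open>Weighting \<open>conj_count n h\<close> by the value of \<open>f\<close> at
  \<open>h\<close> and summing over \<open>h\<close> leaves, for each conjugating \<open>x\<close>,
  the value of \<open>f\<close> at a conjugate of \<open>g\<close>. There are n! choices of
  \<open>x\<close>, hence the divisor.\<close>

lemma class_fun_in_span:
  assumes F: "\<And>r :: nat \<Rightarrow> nat set. in_span n I F (fibre_char n False r)"
    and f: "\<And>x g. x permutes {1..n} \<Longrightarrow> g permutes {1..n} \<Longrightarrow> f (x \<circ> g \<circ> inv' x) = f g"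
  shows "in_span n I F f"
proof -
  have "in_span n I F (\<lambda>g. \<Sum>h | h permutes {1..n}. (f h / fact n) * conj_count n h g)"
    by (rule in_span_lincomb) (auto intro: conj_count_in_span[OF F])
  then show ?thesis
  proof (rule in_span_cong)
    fix g assume g: "g permutes {1..n}"
    have "(\<Sum>h | h permutes {1..n}. (f h / fact n) * conj_count n h g) =
      (\<Sum>x | x permutes {1..n}. \<Sum>h | h permutes {1..n}. if x \<circ> g \<circ> inv' x = h then f h / fact n else 0)"
      unfolding conj_count_def
      by (subst sum.swap) (auto simp: sum_distrib_left if_distrib intro!: sum.cong)
    also have "\<dots> = (\<Sum>x | x permutes {1..n}. f g / fact n)"
    proof (rule sum.cong[OF refl])
      fix x assume "x \<in> {x. x permutes {1..n}}"
      then have x: "x permutes {1..n}" by simp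
      show "(\<Sum>h | h permutes {1..n}. if x \<circ> g \<circ> inv' x = h then f h / fact n else 0) = f g / fact n"
        using f[OF x g] permutes_comp_inv[OF x g] by simp
    qed
    also have "\<dots> = f g" by (simp add: card_permutations[of "{1..n}" n])
    finally show "(\<Sum>h | h permutes {1..n}. (f h / fact n) * conj_count n h g) = f g" .
  qed
qed

text \<open>An arbitrary filling: by \<open>fibre_char_tableau\<close> the characters built from it
  depend only on the shape.\<close>

definition tableau :: "nat \<Rightarrow> (nat \<times> nat) set \<Rightarrow> nat \<Rightarrow> nat \<times> nat" where
  "tableau n Y = (SOME e. bij_betw e {1..n} Y)"

lemma bij_betw_tableau:
  assumes "young_diagram n Y" shows "bij_betw (tableau n Y) {1..n} Y"
proof -
  have "\<exists>e. bij_betw e {1..n} Y"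
    using assms unfolding young_diagram_def by (intro finite_same_card_bij) auto
  then show ?thesis unfolding tableau_def by (rule someI_ex)
qed

section \<open>Row and column characters of a diagram, and their spans\<close>

definition row_char :: "nat \<Rightarrow> (nat \<times> nat) set \<Rightarrow> (nat \<Rightarrow> nat) \<Rightarrow> complex" where
  "row_char n Y = fibre_char n False (\<lambda>x. fst (tableau n Y x))"

definition col_char :: "nat \<Rightarrow> (nat \<times> nat) set \<Rightarrow> (nat \<Rightarrow> nat) \<Rightarrow> complex" where
  "col_char n Y = fibre_char n True (\<lambda>x. snd (tableau n Y x))"

text \<open>Two fillings of the same shape differ by a permutation of the points, to which
  \<open>fibre_char_compose\<close> applies.\<close>

lemma fibre_char_tableau:
  assumes e: "bij_betw e {1..n} Y" and Y: "young_diagram n Y" and g: "g permutes {1..n}"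
    and r: "\<And>x y. x \<in> {1..n} \<Longrightarrow> y \<in> {1..n} \<Longrightarrow> \<pi> (e x) = \<pi> (e y) \<longleftrightarrow> r x = r y"
  shows "fibre_char n b (\<lambda>x. \<pi> (tableau n Y x)) g = fibre_char n b r g"
proof -
  let ?t = "tableau n Y"
  have t: "bij_betw ?t {1..n} Y" by (rule bij_betw_tableau[OF Y])
  define p where "p x = (if x \<in> {1..n} then inv_into {1..n} ?t (e x) else x)" for x
  have "bij_betw (inv_into {1..n} ?t \<circ> e) {1..n} {1..n}"
    by (rule bij_betw_trans[OF e bij_betw_inv_into[OF t]])
  then have "bij_betw p {1..n} {1..n}"
    by (rule bij_betw_cong[THEN iffD1, rotated]) (simp add: p_def)
  then have p: "p permutes {1..n}" by (rule bij_imp_permutes) (simp only: p_def if_False)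
  have tp: "?t (p x) = e x" if "x \<in> {1..n}" for x
  proof -
    have "e x \<in> ?t ` {1..n}"
      using bij_betw_apply[OF e that] bij_betw_imp_surj_on[OF t] by simp
    then show ?thesis unfolding p_def using that by (simp only: f_inv_into_f if_True)
  qed
  have "fibre_char n b (\<lambda>x. \<pi> (?t x)) g = fibre_char n b (\<lambda>x. \<pi> (?t (p x))) g"
    by (rule fibre_char_compose[OF p g, symmetric])
  also have "fibre_group n (\<lambda>x. \<pi> (?t (p x))) = fibre_group n r"
    by (rule fibre_group_cong) (simp only: tp r)
  then have "fibre_char n b (\<lambda>x. \<pi> (?t (p x))) g = fibre_char n b r g"
    unfolding fibre_char_eq[OF g] by simp
  finally show ?thesis .
qed

lemma class_fun_row_span:
  assumes "\<And>x g. x permutes {1..n} \<Longrightarrow> g permutes {1..n} \<Longrightarrow> f (x \<circ> g \<circ> inv' x) = f g"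
  shows "in_span n {Y. young_diagram n Y} (row_char n) f"
proof (rule class_fun_in_span)
  show "f (x \<circ> g \<circ> inv' x) = f g" if "x permutes {1..n}" "g permutes {1..n}" for x g
    by (rule assms[OF that])
next
  fix r :: "nat \<Rightarrow> nat set"
  obtain Y e where Y: "young_diagram n Y" and e: "bij_betw e {1..n} Y"
    and r: "\<And>x y. x \<in> {1..n} \<Longrightarrow> y \<in> {1..n} \<Longrightarrow> fst (e x) = fst (e y) \<longleftrightarrow> r x = r y"
    using ex_young_diagram_fibres[of "{1..n}" r] by auto
  show "in_span n {Y. young_diagram n Y} (row_char n) (fibre_char n False r)"
    by (rule in_span_member[OF finite_young_diagrams, of Y])
      (simp_all only: Y mem_Collect_eq row_char_def fibre_char_tableau[where \<pi> = fst and r = r, OF e Y _ r])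
qed

text \<open>The twist of \<open>f\<close> by the sign is expanded in the permutation characters of
  the column groups, where transposed diagrams realize every partition as columns. Twisting back
  turns these into \<open>col_char\<close>, as the sign squares to 1.\<close>

lemma class_fun_col_span:
  assumes f: "\<And>x g. x permutes {1..n} \<Longrightarrow> g permutes {1..n} \<Longrightarrow> f (x \<circ> g \<circ> inv' x) = f g"
  shows "in_span n {Y. young_diagram n Y} (col_char n) f"
proof -
  let ?F = "\<lambda>Y. fibre_char n False (\<lambda>x. snd (tableau n Y x))"
  have "in_span n {Y. young_diagram n Y} ?F (\<lambda>g. sign_char True g * f g)"
  proof (rule class_fun_in_span)
    fix r :: "nat \<Rightarrow> nat set"
    obtain Y e where Y: "young_diagram n Y" and e: "bij_betw e {1..n} Y"
      and r: "\<And>x y. x \<in> {1..n} \<Longrightarrow> y \<in> {1..n} \<Longrightarrow> fst (e x) = fst (e y) \<longleftrightarrow> r x = r y"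
      using ex_young_diagram_fibres[of "{1..n}" r] by auto
    have Y': "young_diagram n (prod.swap ` Y)" by (rule young_diagram_swap[OF Y])
    have e': "bij_betw (prod.swap \<circ> e) {1..n} (prod.swap ` Y)"
      by (rule bij_betw_trans[OF e]) (simp add: bij_betw_def)
    have r': "snd ((prod.swap \<circ> e) x) = snd ((prod.swap \<circ> e) y) \<longleftrightarrow> r x = r y"
      if "x \<in> {1..n}" "y \<in> {1..n}" for x y using r[OF that] by simp
    show "in_span n {Y. young_diagram n Y} ?F (fibre_char n False r)"
      by (rule in_span_member[OF finite_young_diagrams, of "prod.swap ` Y"])
        (simp_all only: Y' mem_Collect_eq fibre_char_tableau[where \<pi> = snd and r = r, OF e' Y' _ r'])
  next
    fix x g assume "x permutes {1..n}" "g permutes {1..n}"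
    then show "sign_char True (x \<circ> g \<circ> inv' x) * f (x \<circ> g \<circ> inv' x) = sign_char True g * f g"
      by (simp only: f sign_char_conj)
  qed
  then obtain c where c: "\<And>g. g permutes {1..n} \<Longrightarrow>
      sign_char True g * f g = (\<Sum>Y | young_diagram n Y. c Y * ?F Y g)"
    unfolding in_span_def by blast
  have "f g = (\<Sum>Y | young_diagram n Y. c Y * col_char n Y g)" if g: "g permutes {1..n}" for g
  proof -
    have "f g = sign_char True g * (sign_char True g * f g)" by simp
    also have "\<dots> = (\<Sum>Y | young_diagram n Y. c Y * (sign_char True g * ?F Y g))"
      unfolding c[OF g] by (simp add: sum_distrib_left mult.left_commute)
    finally show ?thesis unfolding col_char_def by (simp only: fibre_char_sign[OF g, of True])
  qed
  then show ?thesis unfolding in_span_def by blast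
qed

section \<open>The diagram of an irreducible character\<close>

lemma dominates_if_fibre_inj:
  assumes Y: "young_diagram n Y" and Z: "young_diagram n Z"
    and p: "p permutes {1..n}"
    and inj: "inj_on (\<lambda>x. (fst (tableau n Y x), snd (tableau n Z (p x)))) {1..n}"
  shows "dominates Z Y"
proof (rule dominates_of_inj[OF bij_betw_tableau[OF Y] Z])
  show "bij_betw (tableau n Z \<circ> p) {1..n} Z"
    by (rule bij_betw_trans[OF permutes_imp_bij[OF p] bij_betw_tableau[OF Z]])
qed (use inj in simp)

definition pairing :: "nat \<Rightarrow> ((nat \<Rightarrow> nat) \<Rightarrow> complex) \<Rightarrow> ((nat \<Rightarrow> nat) \<Rightarrow> complex) \<Rightarrow> complex" where
  "pairing n f h = (\<Sum>g | g permutes {1..n}. f g * h g)"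

lemma irr_char_dominates:
  assumes \<chi>: "irr_char (sym_group n) \<chi>" and Y: "young_diagram n Y" and Z: "young_diagram n Z"
    and row: "pairing n (row_char n Y) \<chi> \<noteq> 0" and col: "pairing n (col_char n Z) \<chi> \<noteq> 0"
  shows "dominates Z Y"
proof -
  obtain p where "p permutes {1..n}"
    "inj_on (\<lambda>x. (fst (tableau n Y x), snd (tableau n Z (p x)))) {1..n}"
    using irr_char_fibre_inj[OF \<chi> row[unfolded pairing_def row_char_def]
        col[unfolded pairing_def col_char_def]] by blast
  then show ?thesis by (rule dominates_if_fibre_inj[OF Y Z])
qed

lemma dominates_if_pairing_nonzero:
  assumes Y: "young_diagram n Y" and Z: "young_diagram n Z"
    and nz: "pairing n (row_char n Y) (col_char n Z) \<noteq> 0"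
  shows "dominates Z Y"
proof -
  have "{p. p permutes {1..n} \<and> inj_on (\<lambda>x. (fst (tableau n Y x), snd (tableau n Z (p x)))) {1..n}} \<noteq> {}"
    using nz unfolding pairing_def row_char_def col_char_def sum_fibre_char_mult
    by (metis (no_types, lifting) card.empty mult_zero_right of_nat_0)
  then show ?thesis using dominates_if_fibre_inj[OF Y Z] by blast
qed

text \<open>The identity is always counted, because a cell is determined by its row and its
  column.\<close>

lemma pairing_row_col_diag:
  assumes Y: "young_diagram n Y"
  shows "pairing n (row_char n Y) (col_char n Y) \<noteq> 0"
proof -
  define S where "S = {p. p permutes {1..n} \<and>
    inj_on (\<lambda>x. (fst (tableau n Y x), snd (tableau n Y (p x)))) {1..n}}"
  have "inj_on (tableau n Y) {1..n}" using bij_betw_tableau[OF Y] by (rule bij_betw_imp_inj_on)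
  then have "id \<in> S" unfolding S_def using permutes_id by simp
  moreover have "finite S"
    unfolding S_def by (rule finite_subset[OF _ finite_permutes_interval[of n]]) auto
  ultimately have "card S \<noteq> 0" by auto
  then show ?thesis
    unfolding pairing_def row_char_def col_char_def sum_fibre_char_mult S_def[symmetric] by simp
qed

lemma pairing_sum_left:
  assumes "\<And>g. g permutes {1..n} \<Longrightarrow> f g = (\<Sum>i\<in>I. c i * F i g)"
  shows "pairing n f h = (\<Sum>i\<in>I. c i * pairing n (F i) h)"
proof -
  have "pairing n f h = (\<Sum>g | g permutes {1..n}. \<Sum>i\<in>I. c i * (F i g * h g))"
    unfolding pairing_def using assms by (intro sum.cong refl) (simp add: sum_distrib_right mult.assoc)
  also have "\<dots> = (\<Sum>i\<in>I. c i * pairing n (F i) h)"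
    unfolding pairing_def by (subst sum.swap) (simp add: sum_distrib_left)
  finally show ?thesis .
qed

lemma pairing_commute: "pairing n f h = pairing n h f"
  unfolding pairing_def by (simp add: mult.commute)

text \<open>If \<open>m\<close> is minimal in the support of \<open>c\<close>, then \<open>c m * P m m\<close> is the only nonzero term of the
  sum below.\<close>

lemma ex_min_coeff:
  fixes P :: "'i \<Rightarrow> 'i \<Rightarrow> complex"
  assumes fin: "finite I" and Y: "Y \<in> I" "c Y \<noteq> 0"
    and refl: "\<And>i. R i i"
    and trans: "\<And>i j k. R i j \<Longrightarrow> R j k \<Longrightarrow> R i k"
    and antisym: "\<And>i j. i \<in> I \<Longrightarrow> j \<in> I \<Longrightarrow> R i j \<Longrightarrow> R j i \<Longrightarrow> i = j"
    and tri: "\<And>i j. i \<in> I \<Longrightarrow> j \<in> I \<Longrightarrow> P i j \<noteq> 0 \<Longrightarrow> R i j"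
    and diag: "\<And>i. i \<in> I \<Longrightarrow> P i i \<noteq> 0"
  shows "\<exists>m\<in>I. R m Y \<and> (\<Sum>i\<in>I. c i * P i m) \<noteq> 0"
proof -
  \<comment> \<open>Restricting to indices below \<open>Y\<close> secures \<open>R m Y\<close>; by
    transitivity any support index below \<open>m\<close> is again in \<open>A\<close>, so
    minimality in \<open>A\<close> is minimality in the support.\<close>
  define A where "A = {i \<in> I. c i \<noteq> 0 \<and> R i Y}"
  have "\<exists>m\<in>A. \<forall>i\<in>A. i \<noteq> m \<longrightarrow> \<not> (R i m \<and> i \<noteq> m)"
  proof (rule Finite_Set.bex_min_element)
    show "finite A" "A \<noteq> {}" using fin Y refl unfolding A_def by auto
    show "asymp_on A (\<lambda>i m. R i m \<and> i \<noteq> m)"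
      using antisym unfolding asymp_on_def A_def by blast
    show "transp_on A (\<lambda>i m. R i m \<and> i \<noteq> m)"
      using antisym trans unfolding transp_on_def A_def by blast
  qed
  then obtain m where m: "m \<in> A" and min: "\<And>i. i \<in> A \<Longrightarrow> R i m \<Longrightarrow> i = m" by blast
  have "c i * P i m = 0" if "i \<in> I - {m}" for i
  proof (rule ccontr)
    assume nz: "c i * P i m \<noteq> 0"
    then have "R i m" using tri[of i m] that m unfolding A_def by auto
    moreover from this have "i \<in> A" using trans m that nz unfolding A_def by auto
    ultimately show False using min that by blast
  qed
  then have "(\<Sum>i\<in>I - {m}. c i * P i m) = 0" by (intro sum.neutral ballI)
  then have "(\<Sum>i\<in>I. c i * P i m) = c m * P m m"
    using m unfolding A_def by (simp add: sum.remove[OF fin, of m])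
  then show ?thesis using m diag unfolding A_def by auto
qed

text \<open>\<open>L\<close> is the partition that labels \<open>\<chi>\<close> in the classical parametrization.\<close>

lemma irr_char_type:
  assumes irr: "irr_char (sym_group n) \<chi>"
  defines "I \<equiv> {Y. young_diagram n Y}"
  shows "\<exists>L c d. L \<in> I \<and> pairing n (row_char n L) \<chi> \<noteq> 0 \<and> pairing n (col_char n L) \<chi> \<noteq> 0 \<and>
    c L \<noteq> 0 \<and> d L \<noteq> 0 \<and>
    (\<forall>Y\<in>I. c Y \<noteq> 0 \<longrightarrow> dominates Y L) \<and> (\<forall>Z\<in>I. d Z \<noteq> 0 \<longrightarrow> dominates L Z) \<and>
    (\<forall>g. g permutes {1..n} \<longrightarrow> \<chi> g = (\<Sum>Y\<in>I. c Y * row_char n Y g)) \<and>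
    (\<forall>g. g permutes {1..n} \<longrightarrow> \<chi> g = (\<Sum>Z\<in>I. d Z * col_char n Z g))"
proof -
  define P where "P Y Z = pairing n (row_char n Y) (col_char n Z)" for Y Z
  have fin: "finite I" unfolding I_def by (rule finite_young_diagrams)
  have refl: "dominates Y Y" for Y unfolding dominates_def by simp
  have antisym: "Y = Z" if "Y \<in> I" "Z \<in> I" "dominates Y Z" "dominates Z Y" for Y Z
    using that dominates_antisym unfolding I_def by blast
  have tri: "dominates Z Y" if "Y \<in> I" "Z \<in> I" "P Y Z \<noteq> 0" for Y Z
    using that dominates_if_pairing_nonzero unfolding I_def P_def by blast
  have diag: "P Y Y \<noteq> 0" if "Y \<in> I" for Y
    using that pairing_row_col_diag unfolding I_def P_def by blast
  obtain c where c: "\<And>g. g permutes {1..n} \<Longrightarrow> \<chi> g = (\<Sum>Y\<in>I. c Y * row_char n Y g)"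
    using class_fun_row_span[OF irr_char_class_fun[OF irr]] unfolding in_span_def I_def by blast
  obtain d where d: "\<And>g. g permutes {1..n} \<Longrightarrow> \<chi> g = (\<Sum>Z\<in>I. d Z * col_char n Z g)"
    using class_fun_col_span[OF irr_char_class_fun[OF irr]] unfolding in_span_def I_def by blast
  have row: "pairing n (row_char n Y) \<chi> = (\<Sum>Z\<in>I. d Z * P Y Z)" for Y
    unfolding P_def by (subst (1 2) pairing_commute) (rule pairing_sum_left[OF d])
  have col: "pairing n (col_char n Z) \<chi> = (\<Sum>Y\<in>I. c Y * P Y Z)" for Z
    unfolding P_def by (subst pairing_commute) (rule pairing_sum_left[OF c])
  have cross: "dominates Z Y" if "Y \<in> I" "Z \<in> I"
    "pairing n (row_char n Y) \<chi> \<noteq> 0" "pairing n (col_char n Z) \<chi> \<noteq> 0" for Y Z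
    using irr_char_dominates[OF irr] that unfolding I_def by simp
  have low: "\<exists>m\<in>I. dominates Y m \<and> pairing n (col_char n m) \<chi> \<noteq> 0" if "Y \<in> I" "c Y \<noteq> 0" for Y
    unfolding col
    by (rule ex_min_coeff[where R = "\<lambda>i j. dominates j i" and P = P and c = c, OF fin that(1) that(2)])
      (use refl dominates_trans antisym tri diag in blast)+
  \<comment> \<open>With \<open>P\<close> transposed and the order reversed relative to
    \<open>low\<close>, the minimal index of \<open>ex_min_coeff\<close> is a maximal one for
    dominance.\<close>
  have high: "\<exists>m\<in>I. dominates m Z \<and> pairing n (row_char n m) \<chi> \<noteq> 0" if "Z \<in> I" "d Z \<noteq> 0" for Z
    unfolding row
    by (rule ex_min_coeff[where R = dominates and P = "\<lambda>i j. P j i" and c = d, OF fin that(1) that(2)])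
      (use refl dominates_trans antisym tri diag in blast)+
  have "pairing n \<chi> (\<lambda>g. cnj (\<chi> g)) \<noteq> 0"
    using group.irr_char_norm_nonzero[OF sym_group_is_group irr]
    unfolding pairing_def by (simp add: carrier_sym_group)
  also have "pairing n \<chi> (\<lambda>g. cnj (\<chi> g)) = (\<Sum>Y\<in>I. c Y * (\<Sum>Z\<in>I. cnj (d Z) * P Y Z))"
  proof -
    \<comment> \<open>Column characters are real, so conjugating \<chi> only conjugates its
      coefficients, and the norm becomes a combination of the same numbers
      \<open>P Y Z\<close>.\<close>
    have "cnj (\<chi> g) = (\<Sum>Z\<in>I. cnj (d Z) * col_char n Z g)" if "g permutes {1..n}" for g
      unfolding d[OF that] col_char_def by (simp add: cnj_fibre_char[OF that])
    then have "pairing n (row_char n Y) (\<lambda>g. cnj (\<chi> g)) = (\<Sum>Z\<in>I. cnj (d Z) * P Y Z)" for Y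
      unfolding P_def by (subst (1 2) pairing_commute) (rule pairing_sum_left)
    then show ?thesis using pairing_sum_left[OF c] by simp
  qed
  finally obtain Y where Y: "Y \<in> I" "c Y * (\<Sum>Z\<in>I. cnj (d Z) * P Y Z) \<noteq> 0"
    by (meson sum.neutral)
  then have "(\<Sum>Z\<in>I. cnj (d Z) * P Y Z) \<noteq> 0" by auto
  then obtain Z where Z: "Z \<in> I" "cnj (d Z) * P Y Z \<noteq> 0" by (meson sum.neutral)
  have cY: "c Y \<noteq> 0" and dZ: "d Z \<noteq> 0" and YZ: "dominates Z Y" using Y Z tri by auto
  obtain m where m: "m \<in> I" "dominates Y m" "pairing n (col_char n m) \<chi> \<noteq> 0"
    using low[OF Y(1) cY] by blast
  obtain M where M: "M \<in> I" "dominates M Z" "pairing n (row_char n M) \<chi> \<noteq> 0"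
    using high[OF Z(1) dZ] by blast
  have mM: "dominates m M" using cross M m by blast
  \<comment> \<open>Dominance closes a cycle: \<open>Z\<close> over \<open>Y\<close> over
    \<open>m\<close> over \<open>M\<close> over \<open>Z\<close>. Antisymmetry collapses it to the
    single diagram L.\<close>
  have "Y = m" "Z = m" "M = m"
    using antisym dominates_trans mM m(1,2) M(1,2) YZ Y(1) Z(1) by metis+
  then have L: "m \<in> I" "c m \<noteq> 0" "d m \<noteq> 0" "pairing n (row_char n m) \<chi> \<noteq> 0"
    using cY dZ m M by auto
  \<comment> \<open>Below \<open>Y'\<close> lies a diagram on the column side, and it dominates
    \<open>m\<close> because \<open>m\<close> is on the row side.\<close>
  have "dominates Y' m" if "Y' \<in> I" "c Y' \<noteq> 0" for Y'
    using low[OF that] cross L(1,4) dominates_trans by blast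
  moreover have "dominates m Z'" if "Z' \<in> I" "d Z' \<noteq> 0" for Z'
    using high[OF that] cross m(1,3) dominates_trans by blast
  ultimately show ?thesis using L m(3) c d by blast
qed

text \<open>The one-sided hypotheses are exactly what failure to separate \<chi> from \<psi>
  provides; the conclusion is what orthogonality contradicts.\<close>

lemma pairing_irr_char_nonzero:
  assumes \<chi>: "irr_char (sym_group n) \<chi>" and \<psi>: "irr_char (sym_group n) \<psi>"
    and row: "\<And>Y. young_diagram n Y \<Longrightarrow> pairing n (row_char n Y) \<chi> \<noteq> 0 \<Longrightarrow> pairing n (row_char n Y) \<psi> \<noteq> 0"
    and col: "\<And>Y. young_diagram n Y \<Longrightarrow> pairing n (col_char n Y) \<chi> \<noteq> 0 \<Longrightarrow> pairing n (col_char n Y) \<psi> \<noteq> 0"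
  shows "(\<Sum>g | g permutes {1..n}. \<chi> g * \<psi> (inv' g)) \<noteq> 0"
proof -
  define I where "I = {Y. young_diagram n Y}"
  have fin: "finite I" unfolding I_def by (rule finite_young_diagrams)
  obtain L c where L: "L \<in> I" "pairing n (row_char n L) \<chi> \<noteq> 0" "pairing n (col_char n L) \<chi> \<noteq> 0"
    "c L \<noteq> 0" and c_dom: "\<And>Y. Y \<in> I \<Longrightarrow> c Y \<noteq> 0 \<Longrightarrow> dominates Y L"
    and c: "\<And>g. g permutes {1..n} \<Longrightarrow> \<chi> g = (\<Sum>Y\<in>I. c Y * row_char n Y g)"
    using irr_char_type[OF \<chi>] unfolding I_def by blast
  obtain L' d where L': "L' \<in> I" "pairing n (row_char n L') \<psi> \<noteq> 0" "pairing n (col_char n L') \<psi> \<noteq> 0"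
    "d L' \<noteq> 0" and d_dom: "\<And>Z. Z \<in> I \<Longrightarrow> d Z \<noteq> 0 \<Longrightarrow> dominates L' Z"
    and d: "\<And>g. g permutes {1..n} \<Longrightarrow> \<psi> g = (\<Sum>Z\<in>I. d Z * col_char n Z g)"
    using irr_char_type[OF \<psi>] unfolding I_def by blast
  have cross: "dominates Z Y" if "Y \<in> I" "Z \<in> I"
    "pairing n (row_char n Y) \<psi> \<noteq> 0" "pairing n (col_char n Z) \<psi> \<noteq> 0" for Y Z
    using irr_char_dominates[OF \<psi>] that unfolding I_def by simp
  \<comment> \<open>The hypotheses put \<open>L\<close> on both sides for \<psi>, where
    \<open>L'\<close> already is, so each of the two dominates the other.\<close>
  have "L' = L"
    using dominates_antisym cross L L' row col unfolding I_def by blast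
  define P where "P Y Z = pairing n (row_char n Y) (col_char n Z)" for Y Z
  \<comment> \<open>A nonzero term would give \<open>L\<close> over \<open>Z\<close> over
    \<open>Y\<close> over \<open>L\<close>, hence equality throughout.\<close>
  have zero: "c Y * (d Z * P Y Z) = 0" if "Y \<in> I" "Z \<in> I" "Y \<noteq> L \<or> Z \<noteq> L" for Y Z
  proof (rule ccontr)
    assume "c Y * (d Z * P Y Z) \<noteq> 0"
    then have nz: "c Y \<noteq> 0" "d Z \<noteq> 0" "P Y Z \<noteq> 0" by auto
    have "dominates Z Y" using dominates_if_pairing_nonzero nz(3) that unfolding I_def P_def by blast
    moreover have "dominates Y L" "dominates L Z"
      using c_dom d_dom nz that \<open>L' = L\<close> by auto
    ultimately show False
      using that L(1) dominates_antisym dominates_trans unfolding I_def by blast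
  qed
  have "(\<Sum>g | g permutes {1..n}. \<chi> g * \<psi> (inv' g)) = pairing n \<chi> \<psi>"
    unfolding pairing_def
  proof (intro sum.cong refl)
    fix g assume "g \<in> {g. g permutes {1..n}}"
    then have g: "g permutes {1..n}" by simp
    have "\<psi> (inv' g) = \<psi> g"
      unfolding d[OF g] d[OF permutes_inv[OF g]] col_char_def fibre_char_inverse[OF g] ..
    then show "\<chi> g * \<psi> (inv' g) = \<chi> g * \<psi> g" by simp
  qed
  also have "\<dots> = (\<Sum>Y\<in>I. c Y * pairing n \<psi> (row_char n Y))"
    using pairing_sum_left[OF c] by (simp add: pairing_commute[of n \<psi>])
  also have "\<dots> = (\<Sum>Y\<in>I. \<Sum>Z\<in>I. c Y * (d Z * P Y Z))"
  proof (rule sum.cong[OF refl])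
    fix Y
    have "pairing n \<psi> (row_char n Y) = (\<Sum>Z\<in>I. d Z * pairing n (col_char n Z) (row_char n Y))"
      by (rule pairing_sum_left[OF d])
    then show "c Y * pairing n \<psi> (row_char n Y) = (\<Sum>Z\<in>I. c Y * (d Z * P Y Z))"
      unfolding P_def by (simp add: sum_distrib_left pairing_commute[of n _ "row_char n Y"])
  qed
  also have "\<dots> = (\<Sum>Z\<in>I. c L * (d Z * P L Z))"
    by (subst sum.remove[OF fin L(1)]) (simp add: zero)
  also have "\<dots> = c L * (d L * P L L)"
    using L(1) by (subst sum.remove[OF fin L(1)]) (simp add: zero)
  finally show ?thesis
    using L L'(4) \<open>L' = L\<close> pairing_row_col_diag unfolding I_def P_def by simp
qed

lemma char_inner_fibre_char:
  "char_inner (sym_group n) (fibre_char n b r) \<chi> = cnj (pairing n (fibre_char n b r) \<chi>) / fact n"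
  unfolding char_inner_def sym_group_card_carrier pairing_def
  by (simp add: carrier_sym_group cnj_fibre_char)

theorem theorem2p1:
  fixes n :: nat
  assumes "n \<ge> 1"
  shows "almost_monomial (sym_group n)"
  unfolding almost_monomial_def
proof (intro allI impI, elim conjE, rule ccontr)
  fix \<chi> \<psi> assume \<chi>: "irr_char (sym_group n) \<chi>" and \<psi>: "irr_char (sym_group n) \<psi>" and neq: "\<chi> \<noteq> \<psi>"
    and no: "\<not> (\<exists>H \<phi>. subgroup H (sym_group n) \<and> linear_char (sym_group n\<lparr>carrier := H\<rparr>) \<phi> \<and>
      char_inner (sym_group n) (ind_char (sym_group n) H \<phi>) \<chi> \<noteq> 0 \<and>
      char_inner (sym_group n) (ind_char (sym_group n) H \<phi>) \<psi> = 0)"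
  \<comment> \<open>By \<open>char_inner_fibre_char\<close> the inner product and the pairing vanish
    together, so a Young character occurring in \<chi> but not in \<psi> would be a separating
    pair.\<close>
  have "pairing n (fibre_char n b r) \<psi> \<noteq> 0" if "pairing n (fibre_char n b r) \<chi> \<noteq> 0"
    for b and r :: "nat \<Rightarrow> nat"
    using no that subgroup_fibre_group[of n r] linear_char_fibre_group[of n r b]
      char_inner_fibre_char[of n b r] unfolding fibre_char_def by fastforce
  then have "(\<Sum>g | g permutes {1..n}. \<chi> g * \<psi> (inv' g)) \<noteq> 0"
    by (intro pairing_irr_char_nonzero[OF \<chi> \<psi>]) (simp_all add: row_char_def col_char_def)
  moreover have "(\<Sum>g | g permutes {1..n}. \<chi> g * \<psi> (inv' g)) = 0"
    using group.irr_char_orthogonal[OF sym_group_is_group \<chi> \<psi> neq] by (simp add: carrier_sym_group)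
  ultimately show False by contradiction
qed

end
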